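(* Let $E$ be a real Hilbert space with inner product $(\cdot,\cdot)$ and norm $\|\cdot\|$, let $E_1$ be a closed subspace of $E$ and $E_2=E_1^\perp$. Let $I\in C^1(E,\mathbb{R})$ satisfy: $(I_1)$ $I(u)=\frac12(Lu,u)+B(u)$ for all $u\in E$, where, for $u=u_1+u_2\in E_1\oplus E_2$, $Lu=L_1u_1+L_2u_2$ and $L_i:E_i\to E_i$, $i=1,2$, is a bounded linear self-adjoint mapping; $(I_2)$ $B$ is weakly continuous and uniformly differentiable on bounded subsets of $E$. Then for any $R\in\mathbb{N}$, $\varrho>0$ and $\varepsilon\in\left(0,\frac1{10}\right)$, setting $s:=(R+2)^2$, there exist $k\in\mathbb{N}$ and $\eta\in\Gamma$ such that: (i) $I(\eta_t^{ks}(u))\le I(u)+\varrho$ for all $u\in\mathcal{B}_{R+2}$ and $t\in[0,1]$; (ii) if $c\in\mathbb{R}$ and $\|I'(w)\|(1+\|w\|)\ge\sqrt{2\varepsilon}$ for all $w\in\mathcal{B}_{R+1}\cap I^{-1}([c-\varepsilon,c+\varepsilon])$, then $I(\eta_1^{ks}(u))\le c-\frac{\varepsilon}{2}$ whenever $u\in\mathcal{B}_{R/2}\cap I^{-1}([c-\varepsilon,c+\varepsilon])$.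
   Context: For $u\in E$ write $u=u_1+u_2$ with $u_i\in E_i$, and let $P_i:E\to E_i$, $P_iu=u_i$, be the projector on $E_i$. $B_r$ is the closed ball of $E$ centered at $0$ with radius $r$, and $\mathcal{B}_\tau=(B_\tau\cap E_1)\oplus(B_\tau\cap E_2)$, i.e. the set of $u=u_1+u_2$ with $\|u_1\|\le\tau$ and $\|u_2\|\le\tau$. For a map $h:[0,1]\times E\to E$ write $h_t(u)=h(t,u)$, and let $h_t^j$ denote the $j$-fold composite of $h_t$ with itself: $h_t^1=h_t$ and $h_t^j(u)=h_t(h_t^{j-1}(u))$ for $j>1$. A map is compact if it is continuous and maps bounded sets to relatively compact sets. Weakly continuous: $u_n\rightharpoonup u$ in $E$ implies $B(u_n)\to B(u)$. Uniformly differentiable on bounded subsets of $E$: for any $R,\varepsilon>0$ there is $\delta=\delta(R,\varepsilon)>0$, independent of $u$, such that $|B(u+w)-B(u)-B'(u)w|\le\varepsilon\|w\|$ whenever $u,u+w\in B_R$ and $\|w\|\le\delta$. The class $\Gamma$ is the set of maps $h\in C([0,1]\times E,E)$ such that: $(\Gamma_1)$ $h_t(u)=U_t(u)+K_t(u)$, where $U,K\in C([0,1]\times E,E)$, $U_t$ is a homeomorphism of $E$ onto $E$ and $K_t$ is compact for each $t\in[0,1]$; $(\Gamma_2)$ $U_0(u)=u$, $K_0(u)=0$; $(\Gamma_3)$ $P_iU_t(u)=U_t(P_iu)$, $i=1,2$; $(\Gamma_4)$ $h_t$ maps bounded sets to bounded sets. *)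

theory Defs
  imports "HOL-Analysis.Analysis"
begin

text \<open>Used with complementary subspaces \<open>S\<close> and \<open>T\<close>, where the component in \<open>S\<close> exists and is unique;
  \<open>P\<^sub>1\<close> is \<open>projector E1 (E1\<^sup>\<bottom>)\<close> and \<open>P\<^sub>2\<close> is \<open>projector (E1\<^sup>\<bottom>) E1\<close>.\<close>

definition projector :: "'a::real_vector set \<Rightarrow> 'a set \<Rightarrow> 'a \<Rightarrow> 'a" where
  "projector S T u = (THE v. v \<in> S \<and> (\<exists>w\<in>T. u = v + w))"

definition split_ball :: "'a::real_normed_vector set \<Rightarrow> 'a set \<Rightarrow> real \<Rightarrow> 'a set" where
  "split_ball E1 E2 \<tau> = {u1 + u2 | u1 u2. u1 \<in> cball 0 \<tau> \<inter> E1 \<and> u2 \<in> cball 0 \<tau> \<inter> E2}"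

text \<open>The values of \<open>A\<close> outside the subspace \<open>S\<close> are irrelevant.\<close>

definition bounded_selfadjoint_on :: "'a::real_inner set \<Rightarrow> ('a \<Rightarrow> 'a) \<Rightarrow> bool" where
  "bounded_selfadjoint_on S A \<longleftrightarrow>
     A ` S \<subseteq> S \<and>
     (\<forall>x\<in>S. \<forall>y\<in>S. A (x + y) = A x + A y) \<and>
     (\<forall>a. \<forall>x\<in>S. A (a *\<^sub>R x) = a *\<^sub>R A x) \<and>
     (\<exists>C. \<forall>x\<in>S. norm (A x) \<le> C * norm x) \<and>
     (\<forall>x\<in>S. \<forall>y\<in>S. A x \<bullet> y = x \<bullet> A y)"

definition weakly_converges :: "(nat \<Rightarrow> 'a::real_normed_vector) \<Rightarrow> 'a \<Rightarrow> bool" where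
  "weakly_converges X x \<longleftrightarrow>
     (\<forall>\<phi> :: 'a \<Rightarrow> real. bounded_linear \<phi> \<longrightarrow> (\<lambda>n. \<phi> (X n)) \<longlonglongrightarrow> \<phi> x)"

definition weakly_continuous :: "('a::real_normed_vector \<Rightarrow> real) \<Rightarrow> bool" where
  "weakly_continuous B \<longleftrightarrow> (\<forall>X x. weakly_converges X x \<longrightarrow> (\<lambda>n. B (X n)) \<longlonglongrightarrow> B x)"

definition uniformly_differentiable_on_bounded :: "('a::real_normed_vector \<Rightarrow> real) \<Rightarrow> bool" where
  "uniformly_differentiable_on_bounded B \<longleftrightarrow>
     (\<forall>u. B differentiable (at u)) \<and>
     (\<forall>r>0. \<forall>e>0. \<exists>d>0. \<forall>u w. u \<in> cball 0 r \<longrightarrow> u + w \<in> cball 0 r \<longrightarrow> norm w \<le> d \<longrightarrow>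
        \<bar>B (u + w) - B u - frechet_derivative B (at u) w\<bar> \<le> e * norm w)"

definition compact_map :: "('a::real_normed_vector \<Rightarrow> 'a) \<Rightarrow> bool" where
  "compact_map f \<longleftrightarrow> continuous_on UNIV f \<and> (\<forall>S. bounded S \<longrightarrow> compact (closure (f ` S)))"

text \<open>Maps on \<open>[0,1] \<times> E\<close> are represented by total functions of type \<open>real \<Rightarrow> 'a \<Rightarrow> 'a\<close>,
  unconstrained for times outside \<open>[0,1]\<close>.\<close>

definition Gamma_class :: "'a::real_inner set \<Rightarrow> 'a set \<Rightarrow> (real \<Rightarrow> 'a \<Rightarrow> 'a) set" where
  "Gamma_class E1 E2 = {h.
     continuous_on ({0..1} \<times> UNIV) (\<lambda>(t, u). h t u) \<and>
     (\<exists>U K.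
        continuous_on ({0..1} \<times> UNIV) (\<lambda>(t, u). U t u) \<and>
        continuous_on ({0..1} \<times> UNIV) (\<lambda>(t, u). K t u) \<and>
        (\<forall>t\<in>{0..1}. \<forall>u. h t u = U t u + K t u) \<and>
        (\<forall>t\<in>{0..1}. \<exists>V. homeomorphism UNIV UNIV (U t) V) \<and>
        (\<forall>t\<in>{0..1}. compact_map (K t)) \<and>
        (\<forall>u. U 0 u = u \<and> K 0 u = 0) \<and>
        (\<forall>t\<in>{0..1}. \<forall>u. projector E1 E2 (U t u) = U t (projector E1 E2 u) \<and>
                        projector E2 E1 (U t u) = U t (projector E2 E1 u))) \<and>
     (\<forall>t\<in>{0..1}. \<forall>S. bounded S \<longrightarrow> bounded (h t ` S))}"

end

theory Submission
  imports Defs "HOL-Library.Diagonal_Subsequence"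
begin

text \<open>The deformation is one explicit Euler step of size \<open>t * h\<close>, with \<open>h = 13 / (10 * k)\<close>, for the negative
  gradient flow of \<open>I\<close>, where each component \<open>P\<^sub>i (\<nabla>I u)\<close> is multiplied by a cutoff of \<open>norm (P\<^sub>i u)\<close>.
  Cutting off the components separately has three effects: the linear part
  \<open>u - t * h * (\<Sum>i. cutoff (norm (P\<^sub>i u)) * L\<^sub>i (P\<^sub>i u))\<close> still commutes with the projectors and is a small
  Lipschitz perturbation of the identity; the field still has nonnegative inner product with \<open>\<nabla>I\<close>; and
  a slightly larger split ball is invariant, so that all error estimates are uniform and the \<open>k * s\<close> steps
  raise \<open>I\<close> by at most \<open>\<rho>\<close>. The remaining part involves only \<open>\<nabla>B\<close>, which is a compact map because \<open>B\<close> is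
  weakly continuous and uniformly differentiable. For (ii), an orbit in the band loses almost
  \<open>h * (norm (\<nabla>I u))\<^sup>2\<close> per step; as long as its total loss is below \<open>2 * \<epsilon>\<close> it cannot travel farther than
  \<open>(R + 2) / 2\<close>, so it stays where the gradient bound applies and no cutoff is active, and the total time
  \<open>13 / 10 * (R + 2)\<^sup>2\<close> suffices for a loss of \<open>3 / 2 * \<epsilon>\<close>.\<close>

subsection \<open>Hilbert spaces\<close>

text \<open>A minimizing sequence for the distance from \<open>x\<close> to \<open>S\<close> is
  Cauchy by the parallelogram law, and completeness supplies a nearest point; minimality forces
  orthogonality.\<close>

lemma closed_subspace_projection_exists:
  fixes x :: "'a::{real_inner, complete_space}"
  assumes "subspace S" "closed S"
  obtains p where "p \<in> S" "\<And>y. y \<in> S \<Longrightarrow> (x - p) \<bullet> y = 0"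
proof -
  define d where "d = (INF y\<in>S. (norm (x - y))\<^sup>2)"
  have ne: "S \<noteq> {}" using subspace_0[OF assms(1)] by auto
  have bdd: "bdd_below ((\<lambda>y. (norm (x - y))\<^sup>2) ` S)" by (rule bdd_belowI[of _ 0]) auto
  have d_le: "d \<le> (norm (x - y))\<^sup>2" if "y \<in> S" for y
    unfolding d_def by (rule cINF_lower[OF bdd that])
  have "\<exists>y\<in>S. (norm (x - y))\<^sup>2 < d + 1 / real (Suc n)" for n
    using cINF_less_iff[OF ne bdd, of "d + 1 / real (Suc n)"] unfolding d_def by force
  then obtain y where yS: "\<And>n. y n \<in> S" and y: "\<And>n. (norm (x - y n))\<^sup>2 < d + 1 / real (Suc n)"
    by metis
  have par: "(norm (y n - y m))\<^sup>2 \<le> 2 / real (Suc n) + 2 / real (Suc m)" for n m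
  proof -
    define z where "z = (1/2) *\<^sub>R (y n + y m)"
    have "z \<in> S" unfolding z_def by (intro subspace_scale subspace_add assms yS)
    then have z: "d \<le> (norm (x - z))\<^sup>2" by (rule d_le)
    have "(norm (y n - y m))\<^sup>2 = 2 * (norm (x - y n))\<^sup>2 + 2 * (norm (x - y m))\<^sup>2 - 4 * (norm (x - z))\<^sup>2"
      unfolding z_def power2_norm_eq_inner
      by (simp add: inner_diff_left inner_diff_right inner_add_left inner_add_right inner_commute algebra_simps)
    then show ?thesis using z y[of n] y[of m] by simp
  qed
  have "Cauchy y"
  proof (rule metric_CauchyI)
    fix e :: real assume e: "e > 0"
    obtain N where N: "real N > 4 / e\<^sup>2" using reals_Archimedean2 by blast
    show "\<exists>M. \<forall>m\<ge>M. \<forall>n\<ge>M. dist (y m) (y n) < e"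
    proof (intro exI allI impI)
      fix m n assume mn: "N \<le> m" "N \<le> n"
      have "2 / real (Suc m) \<le> 2 / real (Suc N)" "2 / real (Suc n) \<le> 2 / real (Suc N)"
        using mn by (auto intro!: divide_left_mono)
      with par[of m n] have "(norm (y m - y n))\<^sup>2 \<le> 4 / real (Suc N)" by simp
      also have "\<dots> < e\<^sup>2" using N e by (simp add: field_simps) (smt (verit) zero_less_power)
      finally show "dist (y m) (y n) < e" using e by (simp add: dist_norm power2_less_imp_less)
    qed
  qed
  then obtain p where p: "y \<longlonglongrightarrow> p" by (auto simp: Cauchy_convergent_iff convergent_def)
  have pS: "p \<in> S" using closed_sequentially[OF assms(2) yS p] .
  have "(\<lambda>n. (norm (x - y n))\<^sup>2) \<longlonglongrightarrow> (norm (x - p))\<^sup>2" by (intro tendsto_intros p)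
  moreover have "(\<lambda>n. d + 1 / real (Suc n)) \<longlonglongrightarrow> d + 0"
    by (intro tendsto_intros LIMSEQ_Suc[OF lim_1_over_n])
  ultimately have pd: "(norm (x - p))\<^sup>2 \<le> d"
    using LIMSEQ_le[of _ _ _ d] y by (metis (no_types, lifting) add.right_neutral less_imp_le)
  have "(x - p) \<bullet> v = 0" if v: "v \<in> S" for v
  proof (cases "v = 0")
    case False
    \<comment> \<open>This \<open>t\<close> minimizes the quadratic polynomial
      \<open>(norm (x - (p + t *\<^sub>R v)))\<^sup>2\<close>, so a nonzero
      \<open>(x - p) \<bullet> v\<close> would give a point of \<open>S\<close> strictly closer to
      \<open>x\<close>.\<close>
    define t where "t = ((x - p) \<bullet> v) / (v \<bullet> v)"
    have vv: "v \<bullet> v > 0" using False by simp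
    have "p + t *\<^sub>R v \<in> S" by (intro subspace_scale subspace_add assms pS v)
    then have "(norm (x - p))\<^sup>2 \<le> (norm (x - (p + t *\<^sub>R v)))\<^sup>2" using pd d_le order_trans by blast
    also have "\<dots> = (norm (x - p))\<^sup>2 - 2 * t * ((x - p) \<bullet> v) + t\<^sup>2 * (v \<bullet> v)"
      unfolding power2_norm_eq_inner
      by (simp add: inner_diff_left inner_diff_right inner_add_left inner_add_right inner_commute
            power2_eq_square algebra_simps)
    also have "\<dots> = (norm (x - p))\<^sup>2 - ((x - p) \<bullet> v)\<^sup>2 / (v \<bullet> v)"
      using vv unfolding t_def by (simp add: power2_eq_square field_simps)
    finally have "((x - p) \<bullet> v)\<^sup>2 / (v \<bullet> v) \<le> 0" by simp
    then show ?thesis using vv by (simp add: divide_le_0_iff) 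
  qed simp
  with pS show ?thesis by (rule that)
qed

text \<open>The kernel of a nonzero \<open>f\<close> is a closed hyperplane; a nonzero vector
  orthogonal to it represents \<open>f\<close> after rescaling.\<close>

lemma Riesz_representation:
  fixes f :: "'a::{real_inner, complete_space} \<Rightarrow> real"
  assumes "bounded_linear f"
  obtains z where "\<And>x. f x = z \<bullet> x"
proof (cases "\<forall>x. f x = 0")
  case True
  then show ?thesis using that[of 0] by simp
next
  case False
  interpret bounded_linear f by fact
  from False obtain x0 where x0: "f x0 \<noteq> 0" by blast
  define S where "S = {x. f x = 0}"
  have "subspace S" unfolding S_def by (auto simp: subspace_def zero add scaleR)
  moreover have "closed S" unfolding S_def
    by (intro closed_Collect_eq continuous_intros linear_continuous_on assms)
  ultimately obtain p where p: "p \<in> S" "\<And>y. y \<in> S \<Longrightarrow> (x0 - p) \<bullet> y = 0"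
    using closed_subspace_projection_exists by blast
  define q where "q = x0 - p"
  have fq: "f q \<noteq> 0" using p x0 by (simp add: q_def S_def diff)
  then have qq: "q \<bullet> q \<noteq> 0" using zero by auto
  have "f x = ((f q / (q \<bullet> q)) *\<^sub>R q) \<bullet> x" for x
  proof -
    have "x - (f x / f q) *\<^sub>R q \<in> S" using fq by (simp add: S_def diff scaleR)
    then have "q \<bullet> (x - (f x / f q) *\<^sub>R q) = 0" using p unfolding q_def by blast
    then have "q \<bullet> x = (f x / f q) * (q \<bullet> q)" by (simp add: inner_diff_right)
    then show ?thesis using fq qq by simp
  qed
  then show ?thesis by (rule that)
qed

section \<open>Weak sequential compactness of bounded sequences\<close>

lemma ex_pointwise_convergent_subseq:
  fixes f :: "nat \<Rightarrow> nat \<Rightarrow> real"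
  assumes "\<And>m. bounded (range (\<lambda>n. f n m))"
  obtains r :: "nat \<Rightarrow> nat" where "strict_mono r" "\<And>m. convergent (\<lambda>k. f (r k) m)"
proof -
  interpret subseqs "\<lambda>m r. convergent (\<lambda>k. f (r k) m)"
  proof
    fix m and s :: "nat \<Rightarrow> nat" assume "strict_mono s"
    have "bounded (range (\<lambda>k. f (s k) m))" by (rule bounded_subset[OF assms[of m]]) auto
    then obtain l r where "strict_mono r" "((\<lambda>k. f (s k) m) \<circ> r) \<longlonglongrightarrow> l"
      using bounded_imp_convergent_subsequence by blast
    then show "\<exists>r'. strict_mono r' \<and> convergent (\<lambda>k. f ((s \<circ> r') k) m)"
      by (auto simp: convergent_def o_def)
  qed
  have "convergent (\<lambda>k. f (diagseq k) m)" for m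
  proof -
    \<comment> \<open>Only from index \<open>Suc m\<close> on is the diagonal sequence a subsequence
      of the one chosen for column \<open>m\<close>; the shift is removed afterwards.\<close>
    have "convergent (\<lambda>k. f ((diagseq \<circ> (+) (Suc m)) k) m)"
      by (rule diagseq_holds) (auto simp: o_def dest: convergent_subseq_convergent)
    then have "convergent (\<lambda>k. f (diagseq (k + Suc m)) m)" by (simp add: o_def add.commute)
    then show ?thesis using convergent_ignore_initial_segment[of "\<lambda>k. f (diagseq k) m" "Suc m"] by simp
  qed
  then show ?thesis using subseq_diagseq that by blast
qed

lemma weakly_converges_iff:
  fixes x :: "'a::{real_inner, complete_space}"
  shows "weakly_converges X x \<longleftrightarrow> (\<forall>y. (\<lambda>n. X n \<bullet> y) \<longlonglongrightarrow> x \<bullet> y)"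
proof
  assume "weakly_converges X x"
  then show "\<forall>y. (\<lambda>n. X n \<bullet> y) \<longlonglongrightarrow> x \<bullet> y"
    unfolding weakly_converges_def using bounded_linear_inner_left by blast
next
  assume R: "\<forall>y. (\<lambda>n. X n \<bullet> y) \<longlonglongrightarrow> x \<bullet> y"
  show "weakly_converges X x" unfolding weakly_converges_def
  proof (intro allI impI)
    fix \<phi> :: "'a \<Rightarrow> real" assume "bounded_linear \<phi>"
    then obtain z where "\<And>x. \<phi> x = x \<bullet> z" using Riesz_representation inner_commute by metis
    then show "(\<lambda>n. \<phi> (X n)) \<longlonglongrightarrow> \<phi> x" using R by simp
  qed
qed

text \<open>Diagonal extraction makes all \<open>X (r k) \<bullet> X m\<close> converge. The vectors
  \<open>y\<close> for which \<open>X (r k) \<bullet> y\<close> converges form a closed subspace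
  \<open>Y\<close> containing every \<open>X m\<close>. Vectors orthogonal to \<open>Y\<close> are
  orthogonal to the sequence, so \<open>Y\<close> is the whole space, and the Riesz representative
  of the limit functional is the weak limit.\<close>

lemma bounded_imp_weakly_convergent_subseq:
  fixes X :: "nat \<Rightarrow> 'a::{real_inner, complete_space}"
  assumes "bounded (range X)"
  obtains r x where "strict_mono r" "weakly_converges (X \<circ> r) x"
proof -
  obtain M where M: "\<And>n. norm (X n) \<le> M" using assms by (auto simp: bounded_iff)
  have "bounded (range (\<lambda>n. X n \<bullet> X m))" for m
  proof -
    have "\<bar>X n \<bullet> X m\<bar> \<le> M * M" for n
      using Cauchy_Schwarz_ineq2[of "X n" "X m"] mult_mono[OF M[of n] M[of m]]
        order_trans[OF norm_ge_zero M[of n]] by simp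
    then show ?thesis by (auto simp: bounded_iff)
  qed
  then obtain r where r: "strict_mono r" and cX: "\<And>m. convergent (\<lambda>k. X (r k) \<bullet> X m)"
    using ex_pointwise_convergent_subseq[of "\<lambda>n m. X n \<bullet> X m"] by blast
  define Y where "Y = {y. convergent (\<lambda>k. X (r k) \<bullet> y)}"
  have XY: "X m \<in> Y" for m using cX by (simp add: Y_def)
  have "subspace Y"
    unfolding subspace_def Y_def
    by (auto simp: inner_add_right convergent_const intro!: convergent_add convergent_mult)
  moreover have "closed Y"
  proof (subst closed_sequential_limits, intro allI impI)
    fix y l assume y: "(\<forall>n. y n \<in> Y) \<and> y \<longlonglongrightarrow> l"
    have "Cauchy (\<lambda>k. X (r k) \<bullet> l)"
    proof (rule metric_CauchyI)
      fix e :: real assume e: "e > 0"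
      have M0: "M \<ge> 0" using M[of 0] norm_ge_zero order_trans by blast
      have "e / (3 * (M + 1)) > 0" using e M0 by simp
      then obtain n where n: "norm (y n - l) < e / (3 * (M + 1))"
        using y by (metis LIMSEQ_iff order_refl)
      have close: "\<bar>X (r k) \<bullet> l - X (r k) \<bullet> y n\<bar> < e / 3" for k
      proof -
        have "\<bar>X (r k) \<bullet> l - X (r k) \<bullet> y n\<bar> \<le> norm (X (r k)) * norm (y n - l)"
          by (metis Cauchy_Schwarz_ineq2 inner_diff_right norm_minus_commute)
        also have "\<dots> \<le> (M + 1) * norm (y n - l)"
          using M[of "r k"] by (intro mult_right_mono) auto
        also have "\<dots> < (M + 1) * (e / (3 * (M + 1)))"
          using n M0 by (intro mult_strict_left_mono) auto
        also have "\<dots> = e / 3" using M0 by (simp add: field_simps)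
        finally show ?thesis .
      qed
      have "Cauchy (\<lambda>k. X (r k) \<bullet> y n)" using y by (simp add: Y_def convergent_Cauchy)
      then obtain N where N: "\<And>k j. k \<ge> N \<Longrightarrow> j \<ge> N \<Longrightarrow> \<bar>X (r k) \<bullet> y n - X (r j) \<bullet> y n\<bar> < e / 3"
        using e unfolding Cauchy_def dist_real_def by (meson divide_pos_pos zero_less_numeral)
      show "\<exists>N. \<forall>m\<ge>N. \<forall>k\<ge>N. dist (X (r m) \<bullet> l) (X (r k) \<bullet> l) < e"
      proof (intro exI allI impI)
        fix m k assume "N \<le> m" "N \<le> k"
        then show "dist (X (r m) \<bullet> l) (X (r k) \<bullet> l) < e"
          using N[of m k] close[of m] close[of k] unfolding dist_real_def by linarith
      qed
    qed
    then show "l \<in> Y" by (simp add: Y_def Cauchy_convergent_iff)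
  qed
  ultimately have Y: "y \<in> Y" for y
  proof -
    obtain p where p: "p \<in> Y" "\<And>v. v \<in> Y \<Longrightarrow> (y - p) \<bullet> v = 0"
      using closed_subspace_projection_exists[OF \<open>subspace Y\<close> \<open>closed Y\<close>] by blast
    have "X (r k) \<bullet> y = X (r k) \<bullet> p" for k
      using p(2)[OF XY[of "r k"]] by (simp add: inner_diff_left inner_commute)
    then show ?thesis using p(1) by (simp add: Y_def)
  qed
  define f where "f y = lim (\<lambda>k. X (r k) \<bullet> y)" for y
  have f: "(\<lambda>k. X (r k) \<bullet> y) \<longlonglongrightarrow> f y" for y
    using Y[of y] by (simp add: Y_def f_def convergent_LIMSEQ_iff)
  have "bounded_linear f"
  proof (rule bounded_linear_intro[where K = M])
    fix a b :: 'a and c :: real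
    have "(\<lambda>k. X (r k) \<bullet> (a + b)) \<longlonglongrightarrow> f a + f b"
      unfolding inner_add_right by (intro tendsto_add f)
    then show "f (a + b) = f a + f b" using f LIMSEQ_unique by blast
    have "(\<lambda>k. X (r k) \<bullet> (c *\<^sub>R a)) \<longlonglongrightarrow> c * f a"
      unfolding inner_scaleR_right by (intro tendsto_mult_left f)
    then show "f (c *\<^sub>R a) = c *\<^sub>R f a" using LIMSEQ_unique[OF f] by simp
    have "\<bar>X (r k) \<bullet> a\<bar> \<le> norm a * M" for k
      using Cauchy_Schwarz_ineq2[of "X (r k)" a] mult_right_mono[OF M[of "r k"], of "norm a"]
      by (simp add: mult.commute)
    then show "norm (f a) \<le> norm a * M"
      using tendsto_rabs[OF f[of a]] by (auto intro: LIMSEQ_le_const2)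
  qed
  then obtain x where "\<And>y. f y = x \<bullet> y" using Riesz_representation by blast
  then have "weakly_converges (X \<circ> r) x" using f by (simp add: weakly_converges_iff)
  with r show ?thesis by (rule that)
qed

subsection \<open>Gradients\<close>

text \<open>Solving \<open>u - g u = y\<close> means finding the fixed point of the contraction
  \<open>\<lambda>u. y + g u\<close>; the estimate \<open>lower\<close> gives injectivity and a
  Lipschitz inverse.\<close>

lemma contraction_perturbation_homeomorphism:
  fixes g :: "'a::{real_normed_vector, complete_space} \<Rightarrow> 'a"
  assumes q: "0 \<le> q" "q < 1" and g: "\<And>x y. norm (g x - g y) \<le> q * norm (x - y)"
  shows "\<exists>V. homeomorphism UNIV UNIV (\<lambda>u. u - g u) V"
proof -
  let ?U = "\<lambda>u. u - g u"
  have lower: "(1 - q) * norm (x - y) \<le> norm (?U x - ?U y)" for x y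
    using g[of x y] norm_triangle_ineq2[of "x - y" "g x - g y"] by (simp add: algebra_simps)
  have contU: "continuous_on UNIV ?U"
  proof -
    have "continuous_on UNIV g"
      using g q by (intro lipschitz_on_continuous_on[of q] lipschitz_onI) (auto simp: dist_norm)
    then show ?thesis by (intro continuous_intros)
  qed
  have "\<exists>x. ?U x = y" for y
  proof -
    have "\<exists>!x. y + g x = x"
      by (rule banach_fix_type[of q]) (use q g in \<open>auto simp: dist_norm\<close>)
    then obtain x where "y + g x = x" by blast
    then show ?thesis by (metis add_diff_cancel_right')
  qed
  then obtain V where V: "\<And>y. ?U (V y) = y" by metis
  have inj: "x = y" if "?U x = ?U y" for x y
  proof -
    have "(1 - q) * norm (x - y) \<le> 0" using lower[of x y] that by simp
    then show ?thesis using q by (simp add: mult_le_0_iff)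
  qed
  have "norm (V y - V z) \<le> (1 / (1 - q)) * norm (y - z)" for y z
    using lower[of "V y" "V z"] q unfolding V by (simp add: field_simps)
  then have "continuous_on UNIV V"
    using q by (intro lipschitz_on_continuous_on[of "1 / (1 - q)"] lipschitz_onI) (auto simp: dist_norm)
  then have "homeomorphism UNIV UNIV ?U V"
  proof (intro homeomorphismI)
    show "V (?U x) = x" for x using inj V by blast
  qed (use V contU in auto)
  then show ?thesis by blast
qed

text \<open>A sequence in the closure is shadowed by one in \<open>T\<close> with error below
  \<open>1 / Suc n\<close>, so both converge along the same subsequence.\<close>

lemma compact_closure_seqI:
  fixes T :: "'a::real_normed_vector set"
  assumes "\<And>y :: nat \<Rightarrow> 'a. (\<And>n. y n \<in> T) \<Longrightarrow> \<exists>r l. strict_mono r \<and> (y \<circ> r) \<longlonglongrightarrow> l"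
  shows "compact (closure T)"
  unfolding compact_eq_seq_compact_metric seq_compact_def
proof (intro allI impI)
  fix x :: "nat \<Rightarrow> 'a" assume x: "\<forall>n. x n \<in> closure T"
  have "\<exists>y\<in>T. dist y (x n) < 1 / real (Suc n)" for n
    using x by (simp add: closure_approachable)
  then obtain y where y: "\<And>n. y n \<in> T" "\<And>n. dist (y n) (x n) < 1 / real (Suc n)" by metis
  then obtain r l where r: "strict_mono r" "(y \<circ> r) \<longlonglongrightarrow> l" using assms by blast
  have "(\<lambda>n. dist (y n) (x n)) \<longlonglongrightarrow> 0"
  proof (rule tendsto_sandwich[of "\<lambda>_. 0" _ _ "\<lambda>n. 1 / real (Suc n)"])
    show "(\<lambda>n. 1 / real (Suc n)) \<longlonglongrightarrow> 0" by (rule LIMSEQ_Suc[OF lim_1_over_n])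
  qed (use y in \<open>auto intro!: always_eventually less_imp_le\<close>)
  then have "(\<lambda>n. y n - x n) \<longlonglongrightarrow> 0"
    unfolding dist_norm by (rule tendsto_norm_zero_cancel)
  then have "(\<lambda>n. (y \<circ> r) n - (x \<circ> r) n) \<longlonglongrightarrow> 0"
    using LIMSEQ_subseq_LIMSEQ[OF _ r(1)] unfolding o_def by blast
  then have "(x \<circ> r) \<longlonglongrightarrow> l" using r(2) Lim_transform2 by blast
  moreover have "l \<in> closure T"
    unfolding closure_sequential using r(2) y(1) by (intro exI[of _ "y \<circ> r"]) simp
  ultimately show "\<exists>l\<in>closure T. \<exists>r. strict_mono r \<and> (x \<circ> r) \<longlonglongrightarrow> l" using r(1) by blast
qed

section \<open>Riesz representatives as gradient vectors\<close>

definition riesz :: "('a::{real_inner, complete_space} \<Rightarrow>\<^sub>L real) \<Rightarrow> 'a" where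
  "riesz f = (SOME z. \<forall>x. f x = z \<bullet> x)"

lemma inner_riesz: "riesz f \<bullet> x = blinfun_apply f x"
proof -
  obtain z where "\<And>x. f x = z \<bullet> x"
    using Riesz_representation[OF blinfun.bounded_linear_right[of f]] by blast
  then have "\<exists>z. \<forall>x. f x = z \<bullet> x" by blast
  from someI_ex[OF this] have "\<forall>x. f x = riesz f \<bullet> x" unfolding riesz_def .
  then show ?thesis by simp
qed

text \<open>Testing \<open>f\<close> on its own representative gives one inequality, Cauchy-Schwarz
  the other. Being an isometry, \<open>riesz\<close> carries continuity of a derivative over to the
  gradient.\<close>

lemma norm_riesz: "norm (riesz f) = norm f"
proof (rule antisym)
  have "f (riesz f) = norm (riesz f) * norm (riesz f)"
    by (metis inner_riesz power2_eq_square power2_norm_eq_inner)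
  then have "norm (riesz f) * norm (riesz f) = \<bar>f (riesz f)\<bar>" by simp
  also have "\<dots> \<le> norm f * norm (riesz f)" using norm_blinfun[of f "riesz f"] by simp
  finally show "norm (riesz f) \<le> norm f" by (cases "riesz f = 0") auto
  show "norm f \<le> norm (riesz f)"
    by (rule norm_blinfun_bound) (auto simp: inner_riesz[symmetric] Cauchy_Schwarz_ineq2)
qed

lemma riesz_diff: "riesz (f - g) = riesz f - riesz g"
proof -
  have "(riesz (f - g) - (riesz f - riesz g)) \<bullet> x = 0" for x
    by (simp add: inner_diff_left inner_riesz blinfun.diff_left)
  from this[of "riesz (f - g) - (riesz f - riesz g)"] show ?thesis by simp
qed

lemma continuous_on_riesz: "continuous_on S riesz"
  by (rule lipschitz_on_continuous_on[of 1], rule lipschitz_onI)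
    (auto simp: dist_norm riesz_diff[symmetric] norm_riesz)

lemma weakly_converges_add_scaleR:
  fixes x y :: "'a::{real_inner, complete_space}"
  assumes "weakly_converges X x" "weakly_converges Y y"
  shows "weakly_converges (\<lambda>n. X n + a *\<^sub>R Y n) (x + a *\<^sub>R y)"
  using assms unfolding weakly_converges_iff inner_add_left inner_scaleR_left
  by (intro allI tendsto_add tendsto_mult_left) blast+

lemma weakly_converges_subseq:
  assumes "weakly_converges X x" "strict_mono r"
  shows "weakly_converges (X \<circ> r) x"
  using assms LIMSEQ_subseq_LIMSEQ unfolding weakly_converges_def by (fastforce simp: o_def)

text \<open>If the gradients did not converge, test them against the (weakly subconvergent) unit vectors
  \<open>w n\<close> pointing along the differences: both \<open>b (X n) \<bullet> w n\<close> and \<open>b x \<bullet> w\<close> are, uniformly, difference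
  quotients of \<open>B\<close>, which converge by weak continuity.\<close>

lemma gradient_weak_to_strong:
  fixes B :: "'a::{real_inner, complete_space} \<Rightarrow> real"
  assumes B: "\<And>u. (B has_derivative (\<lambda>w. b u \<bullet> w)) (at u)"
    and wc: "weakly_continuous B" and ud: "uniformly_differentiable_on_bounded B"
    and bX: "bounded (range X)" and X: "weakly_converges X x"
  shows "(\<lambda>n. b (X n)) \<longlonglongrightarrow> b x"
proof (rule ccontr)
  assume "\<not> ?thesis"
  then obtain e where e: "e > 0" and inf: "\<exists>\<^sub>\<infinity>n. \<not> dist (b (X n)) (b x) < e"
    by (auto simp: tendsto_iff not_eventually cofinite_eq_sequentially)
  then obtain r1 :: "nat \<Rightarrow> nat" where r1: "strict_mono r1" "\<And>k. norm (b (X (r1 k)) - b x) \<ge> e"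
    using infinite_enumerate[of "{n. \<not> dist (b (X n)) (b x) < e}"]
    by (auto simp: INFM_iff_infinite dist_norm not_less)
  define v where "v k = (b (X (r1 k)) - b x) /\<^sub>R norm (b (X (r1 k)) - b x)" for k
  have nz: "norm (b (X (r1 k)) - b x) > 0" for k using r1(2)[of k] e by linarith
  have v1: "norm (v k) = 1" for k unfolding v_def using nz[of k] by simp
  have ev: "e \<le> (b (X (r1 k)) - b x) \<bullet> v k" for k
  proof -
    let ?z = "b (X (r1 k)) - b x"
    have "?z \<bullet> v k = inverse (norm ?z) * (norm ?z * norm ?z)"
      by (simp add: v_def dot_square_norm power2_eq_square)
    also have "\<dots> = norm ?z" using nz[of k] by (simp only: mult.assoc[symmetric]) simp
    finally show ?thesis using r1(2)[of k] by simp
  qed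
  have "bounded (range v)" using v1 by (auto simp: bounded_iff)
  then obtain r2 w where r2: "strict_mono r2" and w: "weakly_converges (v \<circ> r2) w"
    using bounded_imp_weakly_convergent_subseq by blast
  define Y where "Y = X \<circ> (r1 \<circ> r2)"
  define y where "y = v \<circ> r2"
  have Y: "weakly_converges Y x" unfolding Y_def
    by (intro weakly_converges_subseq X strict_mono_o r1 r2)
  obtain M where M: "\<And>n. norm (Y n) \<le> M" using bX by (auto simp: bounded_iff Y_def)
  have fr: "frechet_derivative B (at u) = (\<lambda>w. b u \<bullet> w)" for u
    using frechet_derivative_at[OF B] by simp
  \<comment> \<open>The ball of this radius contains \<open>Y k\<close>, \<open>x\<close> and their
    translates by \<open>\<delta>\<close> times a direction, since \<open>\<delta>\<close> will be
    at most 1.\<close>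
  define \<rho> where "\<rho> = \<bar>M\<bar> + 1 + norm x + norm w"
  \<comment> \<open>Makes \<open>e' * (1 + norm w) = e / 4\<close>, so that the remainders at
    \<open>Y k\<close> and at \<open>x\<close> together stay below the gap \<open>e\<close>.\<close>
  define e' where "e' = e / (4 * (1 + norm w))"
  have e': "e' > 0" using e by (simp add: e'_def add_pos_nonneg)
  have "\<rho> > 0" unfolding \<rho>_def by (simp add: add_nonneg_pos add_pos_nonneg)
  then obtain d where d: "d > 0"
    "\<And>u h. norm u \<le> \<rho> \<Longrightarrow> norm (u + h) \<le> \<rho> \<Longrightarrow> norm h \<le> d \<Longrightarrow> \<bar>B (u + h) - B u - b u \<bullet> h\<bar> \<le> e' * norm h"
    using ud e' unfolding uniformly_differentiable_on_bounded_def fr mem_cball_0 by meson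
  \<comment> \<open>The weak limit \<open>w\<close> need not be a unit vector; this scaling keeps
    both displacement lengths, \<open>\<delta>\<close> and \<open>\<delta> * norm w\<close>, within
    \<open>min 1 d\<close>.\<close>
  define \<delta> where "\<delta> = min 1 d / (1 + norm w)"
  have w1: "1 + norm w > 0" by (simp add: add_pos_nonneg)
  have \<delta>: "\<delta> > 0" unfolding \<delta>_def using d(1) w1 by simp
  have \<delta>w: "\<delta> * (1 + norm w) = min 1 d" unfolding \<delta>_def using w1 by simp
  have \<delta>1: "\<delta> \<le> min 1 d" using \<delta>w \<delta> by (smt (verit) mult_le_cancel_left1 norm_ge_zero)
  have \<delta>2: "\<delta> * norm w \<le> min 1 d" using \<delta>w[unfolded distrib_left] \<delta> by linarith
  have \<delta>3: "\<delta> * norm w \<le> norm w" using \<delta>1 by (simp add: mult_left_le_one_le \<delta> less_imp_le)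
  have at_w: "\<bar>B (x + \<delta> *\<^sub>R w) - B x - b x \<bullet> (\<delta> *\<^sub>R w)\<bar> \<le> e' * (\<delta> * norm w)"
    using d(2)[of x "\<delta> *\<^sub>R w"] norm_triangle_ineq[of x "\<delta> *\<^sub>R w"] \<delta> \<delta>2 \<delta>3 by (simp add: \<rho>_def)
  have at_Y: "\<bar>B (Y k + \<delta> *\<^sub>R y k) - B (Y k) - b (Y k) \<bullet> (\<delta> *\<^sub>R y k)\<bar> \<le> e' * \<delta>" for k
  proof -
    have n: "norm (\<delta> *\<^sub>R y k) = \<delta>" using v1 \<delta> by (simp add: y_def)
    have "norm (Y k + \<delta> *\<^sub>R y k) \<le> norm (Y k) + \<delta>"
      using norm_triangle_ineq[of "Y k" "\<delta> *\<^sub>R y k"] n by simp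
    then have a: "norm (Y k + \<delta> *\<^sub>R y k) \<le> \<rho>" "norm (Y k) \<le> \<rho>"
      using M[of k] \<delta>1 norm_ge_zero[of x] norm_ge_zero[of w] unfolding \<rho>_def by linarith+
    show ?thesis using d(2)[OF a(2) a(1)] n \<delta>1 by simp
  qed
  have upper: "\<delta> * e \<le> B (Y k + \<delta> *\<^sub>R y k) - B (Y k) + e' * \<delta> - \<delta> * (b x \<bullet> y k)" for k
  proof -
    have "\<delta> * e \<le> \<delta> * ((b (Y k) - b x) \<bullet> y k)"
      using ev[of "r2 k"] \<delta> by (simp add: Y_def y_def)
    also have "\<dots> = b (Y k) \<bullet> (\<delta> *\<^sub>R y k) - \<delta> * (b x \<bullet> y k)"
      by (simp add: inner_diff_left algebra_simps)
    finally show ?thesis using at_Y[of k] by linarith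
  qed
  have B1: "(\<lambda>k. B (Y k + \<delta> *\<^sub>R y k)) \<longlonglongrightarrow> B (x + \<delta> *\<^sub>R w)"
    using wc weakly_converges_add_scaleR[OF Y w[folded y_def], of \<delta>] unfolding weakly_continuous_def by blast
  have B2: "(\<lambda>k. B (Y k)) \<longlonglongrightarrow> B x" using wc Y unfolding weakly_continuous_def by blast
  have B3: "(\<lambda>k. b x \<bullet> y k) \<longlonglongrightarrow> b x \<bullet> w"
    using w[folded y_def] unfolding weakly_converges_iff inner_commute[of "b x"] by blast
  \<comment> \<open>The lower bound \<open>\<delta> * e\<close> from \<open>upper\<close> survives
    in the limit, where \<open>at_w\<close> bounds the right side by
    \<open>\<delta> * e / 4\<close>.\<close>
  have "(\<lambda>k. B (Y k + \<delta> *\<^sub>R y k) - B (Y k) + e' * \<delta> - \<delta> * (b x \<bullet> y k))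
      \<longlonglongrightarrow> B (x + \<delta> *\<^sub>R w) - B x + e' * \<delta> - \<delta> * (b x \<bullet> w)"
    by (intro tendsto_intros B1 B2 B3)
  then have "\<delta> * e \<le> B (x + \<delta> *\<^sub>R w) - B x + e' * \<delta> - \<delta> * (b x \<bullet> w)"
    by (rule LIMSEQ_le_const) (simp add: upper)
  also have "\<dots> \<le> e' * (1 + norm w) * \<delta>" using at_w by (simp add: algebra_simps)
  also have "e' * (1 + norm w) = e / 4" 
  proof -
    have "0 < 4 * (1 + norm w)" by (intro mult_pos_pos w1) simp
    then have "e' * (4 * (1 + norm w)) = e" using nonzero_eq_divide_eq e'_def by (metis less_irrefl)
    then show ?thesis using mult.left_commute[of e' 4 "1 + norm w"] by linarith
  qed
  finally have "\<delta> * e \<le> \<delta> * (e / 4)" by (simp add: mult.commute)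
  then show False using \<delta> e by simp
qed

text \<open>Bounded sequences have weakly convergent subsequences, and along these the gradients
  converge in norm.\<close>

lemma compact_map_gradient:
  fixes B :: "'a::{real_inner, complete_space} \<Rightarrow> real"
  assumes B: "\<And>u. (B has_derivative (\<lambda>w. b u \<bullet> w)) (at u)" and cb: "continuous_on UNIV b"
    and wc: "weakly_continuous B" and ud: "uniformly_differentiable_on_bounded B"
  shows "compact_map b"
  unfolding compact_map_def
proof (intro conjI allI impI cb compact_closure_seqI)
  fix S and y :: "nat \<Rightarrow> 'a" assume S: "bounded S" and y: "\<And>n. y n \<in> b ` S"
  have "\<forall>n. \<exists>z. z \<in> S \<and> y n = b z" using y by blast
  then obtain X where X: "\<And>n. X n \<in> S" "\<And>n. y n = b (X n)" by metis
  have bX: "bounded (range X)" by (rule bounded_subset[OF S]) (use X in auto)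
  then obtain r x where r: "strict_mono r" and x: "weakly_converges (X \<circ> r) x"
    using bounded_imp_weakly_convergent_subseq by blast
  have "bounded (range (X \<circ> r))" by (rule bounded_subset[OF bX]) auto
  from gradient_weak_to_strong[OF B wc ud this x] have "(y \<circ> r) \<longlonglongrightarrow> b x"
    by (simp add: X o_def)
  with r show "\<exists>r l. strict_mono r \<and> (y \<circ> r) \<longlonglongrightarrow> l" by blast
qed

subsection \<open>Orthogonal splittings and damped vectors\<close>

text \<open>Piecewise linear: 1 up to \<open>\<tau> - 1\<close>, then decreasing with slope -1, and
  0 from \<open>\<tau>\<close> on.\<close>

definition cutoff :: "real \<Rightarrow> real \<Rightarrow> real" where
  "cutoff \<tau> r = max 0 (min 1 (\<tau> - r))"

lemma cutoff_bounds: "0 \<le> cutoff \<tau> r" "cutoff \<tau> r \<le> 1"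
  by (auto simp: cutoff_def)

text \<open>With \<open>norm a \<le> norm b\<close> by symmetry, the variation of the cutoff is made
  to multiply the shorter vector: either its norm is below \<open>\<tau>\<close>, or both products
  vanish.\<close>

lemma cutoff_scaleR_lipschitz:
  fixes a b :: "'a::real_normed_vector"
  assumes "\<tau> \<ge> 0"
  shows "norm (cutoff \<tau> (norm a) *\<^sub>R a - cutoff \<tau> (norm b) *\<^sub>R b) \<le> (1 + \<tau>) * norm (a - b)"
proof -
  have *: "norm (cutoff \<tau> (norm a) *\<^sub>R a - cutoff \<tau> (norm b) *\<^sub>R b) \<le> (1 + \<tau>) * norm (a - b)"
    if ab: "norm a \<le> norm b" for a b :: 'a
  proof (cases "norm a < \<tau>")
    case True
    have "\<bar>cutoff \<tau> (norm a) - cutoff \<tau> (norm b)\<bar> \<le> \<bar>norm a - norm b\<bar>"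
      by (auto simp: cutoff_def)
    also have "\<dots> \<le> norm (a - b)" by (rule norm_triangle_ineq3)
    finally have c: "\<bar>cutoff \<tau> (norm a) - cutoff \<tau> (norm b)\<bar> \<le> norm (a - b)" .
    have "cutoff \<tau> (norm a) *\<^sub>R a - cutoff \<tau> (norm b) *\<^sub>R b
        = cutoff \<tau> (norm b) *\<^sub>R (a - b) + (cutoff \<tau> (norm a) - cutoff \<tau> (norm b)) *\<^sub>R a"
      by (simp add: algebra_simps)
    then have "norm (cutoff \<tau> (norm a) *\<^sub>R a - cutoff \<tau> (norm b) *\<^sub>R b)
        \<le> cutoff \<tau> (norm b) * norm (a - b) + \<bar>cutoff \<tau> (norm a) - cutoff \<tau> (norm b)\<bar> * norm a"
      by (metis cutoff_bounds(1) abs_of_nonneg norm_scaleR norm_triangle_ineq)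
    also have "\<dots> \<le> 1 * norm (a - b) + norm (a - b) * \<tau>"
      using True c assms cutoff_bounds by (intro add_mono mult_mono) auto
    finally show ?thesis by (simp add: algebra_simps)
  next
    case False
    then show ?thesis using ab assms by (simp add: cutoff_def)
  qed
  show ?thesis
    using *[of a b] *[of b a] by (cases "norm a \<le> norm b") (auto simp: norm_minus_commute)
qed

section \<open>Projectors of an orthogonal splitting and componentwise damping\<close>

locale orthogonal_splitting =
  fixes E1 E2 :: "'a::{real_inner, complete_space} set"
  assumes subspace_E1: "subspace E1" and closed_E1: "closed E1" and E2_eq: "E2 = E1\<^sup>\<bottom>"
begin

abbreviation P1 :: "'a \<Rightarrow> 'a" where "P1 \<equiv> projector E1 E2"
abbreviation P2 :: "'a \<Rightarrow> 'a" where "P2 \<equiv> projector E2 E1"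

lemma subspace_E2: "subspace E2"
  by (simp add: E2_eq subspace_orthogonal_comp)

lemma inner_E1_E2: "x \<in> E1 \<Longrightarrow> y \<in> E2 \<Longrightarrow> x \<bullet> y = 0"
  by (simp add: E2_eq orthogonal_comp_def orthogonal_def)

lemma E1_Int_E2: "x \<in> E1 \<Longrightarrow> x \<in> E2 \<Longrightarrow> x = 0"
  using inner_E1_E2[of x x] by simp

lemma decomposition_unique:
  assumes "p \<in> E1" "q \<in> E2" "p' \<in> E1" "q' \<in> E2" "p + q = p' + q'"
  shows "p = p'" "q = q'"
proof -
  have eq: "p - p' = q' - q" using assms(5) by (simp add: algebra_simps)
  have "p - p' \<in> E1" "q' - q \<in> E2" using assms subspace_diff subspace_E1 subspace_E2 by blast+
  then have "p - p' = 0" using E1_Int_E2 eq by metis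
  then show "p = p'" "q = q'" using assms(5) by auto
qed

lemma P1_eqI: "p \<in> E1 \<Longrightarrow> q \<in> E2 \<Longrightarrow> P1 (p + q) = p"
  unfolding projector_def by (rule the_equality) (use decomposition_unique in blast)+

lemma P2_eqI: "p \<in> E1 \<Longrightarrow> q \<in> E2 \<Longrightarrow> P2 (p + q) = q"
  unfolding projector_def
  by (rule the_equality) (metis add.commute, metis add.commute decomposition_unique(2))

lemma decomposition:
  obtains p q where "p \<in> E1" "q \<in> E2" "u = p + q"
proof -
  obtain p where p: "p \<in> E1" "\<And>y. y \<in> E1 \<Longrightarrow> (u - p) \<bullet> y = 0"
    using closed_subspace_projection_exists[OF subspace_E1 closed_E1] by blast
  have "u - p \<in> E2"
    using p(2) by (simp add: E2_eq orthogonal_comp_def orthogonal_def inner_commute)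
  then show ?thesis using that[of p "u - p"] p(1) by simp
qed

lemma P1_in: "P1 u \<in> E1" by (metis decomposition P1_eqI)
lemma P2_in: "P2 u \<in> E2" by (metis decomposition P2_eqI)
lemma P1_plus_P2: "P1 u + P2 u = u" by (metis decomposition P1_eqI P2_eqI)

lemma P1_E1: "x \<in> E1 \<Longrightarrow> P1 x = x" using P1_eqI[of x 0] subspace_0[OF subspace_E2] by simp
lemma P2_E1: "x \<in> E1 \<Longrightarrow> P2 x = 0" using P2_eqI[of x 0] subspace_0[OF subspace_E2] by simp
lemma P1_E2: "x \<in> E2 \<Longrightarrow> P1 x = 0" using P1_eqI[of 0 x] subspace_0[OF subspace_E1] by simp
lemma P2_E2: "x \<in> E2 \<Longrightarrow> P2 x = x" using P2_eqI[of 0 x] subspace_0[OF subspace_E1] by simp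

lemma P_add: "P1 (x + y) = P1 x + P1 y" "P2 (x + y) = P2 x + P2 y"
proof -
  have "x + y = (P1 x + P1 y) + (P2 x + P2 y)" by (metis P1_plus_P2 add.assoc add.left_commute)
  moreover have "P1 x + P1 y \<in> E1" "P2 x + P2 y \<in> E2"
    by (intro subspace_add subspace_E1 subspace_E2 P1_in P2_in)+
  ultimately show "P1 (x + y) = P1 x + P1 y" "P2 (x + y) = P2 x + P2 y"
    using P1_eqI P2_eqI by metis+
qed

lemma P_scaleR: "P1 (a *\<^sub>R x) = a *\<^sub>R P1 x" "P2 (a *\<^sub>R x) = a *\<^sub>R P2 x"
proof -
  have "a *\<^sub>R x = a *\<^sub>R P1 x + a *\<^sub>R P2 x" by (metis P1_plus_P2 scaleR_add_right)
  moreover have "a *\<^sub>R P1 x \<in> E1" "a *\<^sub>R P2 x \<in> E2"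
    by (intro subspace_scale subspace_E1 subspace_E2 P1_in P2_in)+
  ultimately show "P1 (a *\<^sub>R x) = a *\<^sub>R P1 x" "P2 (a *\<^sub>R x) = a *\<^sub>R P2 x"
    using P1_eqI P2_eqI by metis+
qed

lemma pythagoras: "(norm u)\<^sup>2 = (norm (P1 u))\<^sup>2 + (norm (P2 u))\<^sup>2"
  by (metis P1_plus_P2 norm_add_Pythagorean orthogonal_def inner_E1_E2 P1_in P2_in)

lemma norm_P1: "norm (P1 u) \<le> norm u"
  by (rule power2_le_imp_le) (auto simp: pythagoras[of u])

lemma norm_P2: "norm (P2 u) \<le> norm u"
  by (rule power2_le_imp_le) (auto simp: pythagoras[of u])

lemma bounded_linear_P1: "bounded_linear P1"
  by (rule bounded_linear_intro[where K = 1]) (auto simp: P_add P_scaleR norm_P1)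

lemma bounded_linear_P2: "bounded_linear P2"
  by (rule bounded_linear_intro[where K = 1]) (auto simp: P_add P_scaleR norm_P2)

lemma P_diff: "P1 (x - y) = P1 x - P1 y" "P2 (x - y) = P2 x - P2 y"
  using linear_diff bounded_linear.linear bounded_linear_P1 bounded_linear_P2 by blast+

lemma split_ball_iff: "u \<in> split_ball E1 E2 \<tau> \<longleftrightarrow> norm (P1 u) \<le> \<tau> \<and> norm (P2 u) \<le> \<tau>"
proof
  assume "u \<in> split_ball E1 E2 \<tau>"
  then show "norm (P1 u) \<le> \<tau> \<and> norm (P2 u) \<le> \<tau>"
    by (auto simp: split_ball_def P1_eqI P2_eqI)
next
  assume "norm (P1 u) \<le> \<tau> \<and> norm (P2 u) \<le> \<tau>"
  then have "P1 u \<in> cball 0 \<tau> \<inter> E1" "P2 u \<in> cball 0 \<tau> \<inter> E2" by (auto simp: P1_in P2_in)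
  then have "P1 u + P2 u \<in> split_ball E1 E2 \<tau>" unfolding split_ball_def by blast
  then show "u \<in> split_ball E1 E2 \<tau>" by (simp only: P1_plus_P2)
qed

text \<open>The weights come from the components of \<open>u\<close>, the vector being damped is
  \<open>z\<close>. Hence \<open>damp\<close> is linear in \<open>z\<close>, and a linear map
  commuting with the projectors can be pulled out of it.\<close>

definition damp :: "real \<Rightarrow> 'a \<Rightarrow> 'a \<Rightarrow> 'a" where
  "damp \<tau> u z = cutoff \<tau> (norm (P1 u)) *\<^sub>R P1 z + cutoff \<tau> (norm (P2 u)) *\<^sub>R P2 z"

lemma P1_damp: "P1 (damp \<tau> u z) = cutoff \<tau> (norm (P1 u)) *\<^sub>R P1 z"
  and P2_damp: "P2 (damp \<tau> u z) = cutoff \<tau> (norm (P2 u)) *\<^sub>R P2 z"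
  by (simp_all add: damp_def P_add P_scaleR P1_E1 P1_E2 P2_E1 P2_E2 P1_in P2_in)

lemma norm_damp_le: "norm (damp \<tau> u z) \<le> norm z"
proof (rule power2_le_imp_le)
  have "(cutoff \<tau> r * norm x)\<^sup>2 \<le> (norm x)\<^sup>2" for r and x :: 'a
    using cutoff_bounds[of \<tau> r] by (intro power_mono mult_left_le_one_le) auto
  then show "(norm (damp \<tau> u z))\<^sup>2 \<le> (norm z)\<^sup>2"
    unfolding pythagoras[of "damp \<tau> u z"] pythagoras[of z] P1_damp P2_damp
    using cutoff_bounds by (auto intro!: add_mono)
qed simp

text \<open>By orthogonality \<open>z \<bullet> P1 z\<close> and \<open>z \<bullet> P2 z\<close> are
  squared norms, so a damped gradient remains an ascent direction.\<close>

lemma inner_damp: "z \<bullet> damp \<tau> u z \<ge> 0"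
proof -
  have "z \<bullet> P1 z = (norm (P1 z))\<^sup>2" "z \<bullet> P2 z = (norm (P2 z))\<^sup>2"
    using inner_add_left[of "P1 z" "P2 z" "P1 z"] inner_add_left[of "P1 z" "P2 z" "P2 z"]
      inner_E1_E2[OF P1_in P2_in, of z z]
    by (auto simp: P1_plus_P2 power2_norm_eq_inner inner_commute)
  then show ?thesis unfolding damp_def by (simp add: inner_add_right cutoff_bounds)
qed

lemma damp_eq_self:
  assumes "u \<in> split_ball E1 E2 (\<tau> - 1)"
  shows "damp \<tau> u z = z"
  using assms P1_plus_P2[of z] unfolding split_ball_iff damp_def cutoff_def by simp

text \<open>Each component is treated alone: below norm \<open>\<tau>\<close> it moves by at most 1,
  from \<open>\<tau>\<close> on it is frozen.\<close>

lemma damped_step_in_split_ball: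
  assumes u: "u \<in> split_ball E1 E2 (\<tau> + 1)" and h: "0 \<le> h" "h * norm z \<le> 1"
  shows "u - h *\<^sub>R damp \<tau> u z \<in> split_ball E1 E2 (\<tau> + 1)"
proof -
  have *: "norm (x - h *\<^sub>R (cutoff \<tau> (norm x) *\<^sub>R y)) \<le> \<tau> + 1"
    if "norm x \<le> \<tau> + 1" "norm y \<le> norm z" for x y :: 'a
  proof (cases "norm x < \<tau>")
    case True
    have "norm (h *\<^sub>R (cutoff \<tau> (norm x) *\<^sub>R y)) = cutoff \<tau> (norm x) * (h * norm y)"
      using h by (simp add: cutoff_bounds)
    also have "\<dots> \<le> 1 * (h * norm z)"
      using h that cutoff_bounds by (intro mult_mono) (auto intro: mult_left_mono)
    finally show ?thesis using True h norm_triangle_ineq4[of x "h *\<^sub>R (cutoff \<tau> (norm x) *\<^sub>R y)"] by simp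
  next
    case False
    then show ?thesis using that by (simp add: cutoff_def)
  qed
  then show ?thesis
    using u norm_P1[of z] norm_P2[of z] unfolding split_ball_iff P_diff P_scaleR P1_damp P2_damp by blast
qed

text \<open>Applied through \<open>damp \<tau> u (L u) = L (damp \<tau> u u)\<close>, which makes
  the damped linear part Lipschitz.\<close>

lemma damp_self_lipschitz:
  assumes "\<tau> \<ge> 0"
  shows "norm (damp \<tau> x x - damp \<tau> y y) \<le> 2 * (1 + \<tau>) * norm (x - y)"
proof -
  have 1: "norm (cutoff \<tau> (norm (P1 x)) *\<^sub>R P1 x - cutoff \<tau> (norm (P1 y)) *\<^sub>R P1 y) \<le> (1 + \<tau>) * norm (x - y)"
    using cutoff_scaleR_lipschitz[OF assms, of "P1 x" "P1 y"]
      mult_left_mono[OF norm_P1[of "x - y"], of "1 + \<tau>"] assms unfolding P_diff by linarith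
  have 2: "norm (cutoff \<tau> (norm (P2 x)) *\<^sub>R P2 x - cutoff \<tau> (norm (P2 y)) *\<^sub>R P2 y) \<le> (1 + \<tau>) * norm (x - y)"
    using cutoff_scaleR_lipschitz[OF assms, of "P2 x" "P2 y"]
      mult_left_mono[OF norm_P2[of "x - y"], of "1 + \<tau>"] assms unfolding P_diff by linarith
  have "damp \<tau> x x - damp \<tau> y y
      = (cutoff \<tau> (norm (P1 x)) *\<^sub>R P1 x - cutoff \<tau> (norm (P1 y)) *\<^sub>R P1 y)
      + (cutoff \<tau> (norm (P2 x)) *\<^sub>R P2 x - cutoff \<tau> (norm (P2 y)) *\<^sub>R P2 y)"
    by (simp add: damp_def)
  then have "norm (damp \<tau> x x - damp \<tau> y y) \<le> (1 + \<tau>) * norm (x - y) + (1 + \<tau>) * norm (x - y)"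
    using norm_triangle_le[OF add_mono[OF 1 2]] by simp
  then show ?thesis by (simp add: algebra_simps)
qed

lemma continuous_on_damp:
  assumes "continuous_on A f" "continuous_on A g"
  shows "continuous_on A (\<lambda>x. damp \<tau> (f x) (g x))"
  unfolding damp_def cutoff_def
  by (intro continuous_intros assms bounded_linear.continuous_on[OF bounded_linear_P1]
      bounded_linear.continuous_on[OF bounded_linear_P2])

text \<open>\<open>U\<close> carries the damped linear part and is a contractive perturbation of the
  identity by the bound on \<open>h\<close>; \<open>K\<close> carries the damped \<open>b\<close>
  and inherits its compactness.\<close>

lemma damped_step_in_Gamma_class:
  assumes L: "bounded_linear L" and PL: "\<And>u. P1 (L u) = L (P1 u)" "\<And>u. P2 (L u) = L (P2 u)"
    and C: "\<And>u. norm (L u) \<le> C * norm u" and b: "compact_map b"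
    and \<tau>: "\<tau> \<ge> 0" and h: "h \<ge> 0" "h * (C * (2 * (1 + \<tau>))) < 1"
  shows "(\<lambda>t u. u - (t * h) *\<^sub>R damp \<tau> u (L u + b u)) \<in> Gamma_class E1 E2"
proof -
  interpret L: bounded_linear L by fact
  define U where "U t u = u - (t * h) *\<^sub>R damp \<tau> u (L u)" for t u
  define K where "K t u = - ((t * h) *\<^sub>R damp \<tau> u (b u))" for t u
  have damp_add: "damp \<tau> u (x + y) = damp \<tau> u x + damp \<tau> u y" for u x y
    by (simp add: damp_def P_add algebra_simps)
  have damp_L: "damp \<tau> u (L x) = L (damp \<tau> u x)" for u x
    by (simp add: damp_def PL L.add L.scaleR)
  have cont_b: "continuous_on A b" for A
    using b continuous_on_subset unfolding compact_map_def by blast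
  have cont_snd: "continuous_on A (\<lambda>p. f (snd p))" if "continuous_on UNIV f"
    for A :: "(real \<times> 'a) set" and f :: "'a \<Rightarrow> 'a"
    by (rule continuous_on_compose2[OF that]) (auto intro: continuous_intros)
  have cont_L: "continuous_on UNIV L" using linear_continuous_on[OF L] .
  have contU: "continuous_on ({0..1} \<times> UNIV) (\<lambda>(t, u). U t u)"
    unfolding U_def case_prod_beta by (intro continuous_intros continuous_on_damp cont_snd cont_L)
  have contK: "continuous_on ({0..1} \<times> UNIV) (\<lambda>(t, u). K t u)"
    unfolding K_def case_prod_beta by (intro continuous_intros continuous_on_damp cont_snd cont_b)
  have eq: "u - (t * h) *\<^sub>R damp \<tau> u (L u + b u) = U t u + K t u" for t u
    by (simp add: U_def K_def damp_add algebra_simps)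
  have "continuous_on ({0..1} \<times> UNIV) (\<lambda>(t, u). U t u + K t u)"
    using continuous_on_add[OF contU contK] by (simp add: case_prod_beta)
  moreover have "\<exists>V. homeomorphism UNIV UNIV (U t) V" if t: "t \<in> {0..1}" for t
  proof -
    define q where "q = t * (h * (C * (2 * (1 + \<tau>))))"
    have C0: "C * norm x \<ge> 0" for x :: 'a using C[of x] norm_ge_zero order_trans by blast
    show ?thesis
    \<comment> \<open>\<open>C \<ge> 0\<close> can be inferred only from a nonzero vector, so the
      trivial space is handled separately.\<close>
    proof (cases "\<exists>x :: 'a. x \<noteq> 0")
      case True
      then obtain x :: 'a where "x \<noteq> 0" by blast
      then have C0: "C \<ge> 0" using C0[of x] by (simp add: zero_le_mult_iff)
      have q: "0 \<le> q" using t h C0 \<tau> unfolding q_def by simp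
      have "q \<le> 1 * (h * (C * (2 * (1 + \<tau>))))"
        unfolding q_def using t h C0 \<tau> by (intro mult_right_mono) auto
      then have "q < 1" using h by linarith
      have lip: "norm ((t * h) *\<^sub>R damp \<tau> x (L x) - (t * h) *\<^sub>R damp \<tau> y (L y)) \<le> q * norm (x - y)" for x y
      proof -
        have "norm ((t * h) *\<^sub>R damp \<tau> x (L x) - (t * h) *\<^sub>R damp \<tau> y (L y))
            = norm ((t * h) *\<^sub>R L (damp \<tau> x x - damp \<tau> y y))"
          by (simp add: damp_L L.diff scaleR_diff_right)
        also have "\<dots> = (t * h) * norm (L (damp \<tau> x x - damp \<tau> y y))" using t h by simp
        also have "\<dots> \<le> (t * h) * (C * (2 * (1 + \<tau>) * norm (x - y)))"
          using t h C0 order_trans[OF C mult_left_mono[OF damp_self_lipschitz[OF \<tau>] C0]]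
          by (intro mult_left_mono) auto
        finally show ?thesis by (simp add: q_def algebra_simps)
      qed
      show ?thesis
        unfolding U_def by (rule contraction_perturbation_homeomorphism[OF q \<open>q < 1\<close> lip])
    next
      case False
      then have z: "x = 0" for x :: 'a by blast
      have "U t u = u" for u by (rule trans[OF z z[symmetric]])
      then have "U t = (\<lambda>u. u)" by (rule ext)
      then show ?thesis using homeomorphism_ident[of "UNIV :: 'a set"] by auto
    qed
  qed
  moreover have "compact_map (K t)" for t
    unfolding compact_map_def
  proof (intro conjI allI impI)
    show "continuous_on UNIV (K t)" unfolding K_def
      by (intro continuous_intros continuous_on_damp cont_b)
    fix S :: "'a set" assume "bounded S"
    then have cl: "compact (closure (b ` S))" using b by (simp add: compact_map_def)
    define F :: "real \<times> real \<times> 'a \<Rightarrow> 'a" where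
      "F = (\<lambda>p. - ((t * h) *\<^sub>R (fst p *\<^sub>R P1 (snd (snd p)) + fst (snd p) *\<^sub>R P2 (snd (snd p)))))"
    define D where "D = F ` ({0..1} \<times> {0..1} \<times> closure (b ` S))"
    have "compact D" unfolding D_def F_def
      by (intro compact_continuous_image compact_Times cl compact_Icc continuous_intros
          bounded_linear.continuous_on[OF bounded_linear_P1] bounded_linear.continuous_on[OF bounded_linear_P2])
    have "K t ` S \<subseteq> D"
    proof
      fix y assume "y \<in> K t ` S"
      then obtain u where u: "u \<in> S" "y = K t u" by blast
      have "y = F (cutoff \<tau> (norm (P1 u)), cutoff \<tau> (norm (P2 u)), b u)"
        using u by (simp add: F_def K_def damp_def)
      moreover have "b u \<in> closure (b ` S)" using u(1) by (intro subsetD[OF closure_subset] imageI)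
      ultimately show "y \<in> D" unfolding D_def using cutoff_bounds by auto
    qed
    then have "closure (K t ` S) \<subseteq> D"
      using \<open>compact D\<close> by (intro closure_minimal compact_imp_closed)
    then show "compact (closure (K t ` S))"
      using compact_Int_closed[OF \<open>compact D\<close>, of "closure (K t ` S)"] by (simp add: Int_absorb1)
  qed
  \<comment> \<open>Each weight depends only on the component it multiplies, so projecting before
    the step leaves that weight unchanged.\<close>
  moreover have "P1 (U t u) = U t (P1 u)" "P2 (U t u) = U t (P2 u)" for t u
    by (simp_all add: U_def P_diff P_scaleR P1_damp P2_damp)
      (simp_all add: damp_def PL P1_E1 P1_E2 P2_E1 P2_E2 P1_in P2_in L.zero)
  moreover have "bounded ((\<lambda>u. U t u + K t u) ` S)" if bS: "bounded S" for t S
  proof -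
    obtain M where M: "\<And>u. u \<in> S \<Longrightarrow> norm u \<le> M" using bS by (auto simp: bounded_iff)
    have "bounded (b ` S)"
      using b bS closure_subset compact_imp_bounded bounded_subset unfolding compact_map_def by metis
    then obtain N where N: "\<And>u. u \<in> S \<Longrightarrow> norm (b u) \<le> N" by (auto simp: bounded_iff)
    have "norm (U t u + K t u) \<le> M + \<bar>t * h\<bar> * (\<bar>C\<bar> * M + N)" if u: "u \<in> S" for u
    proof -
      have "norm (L u) \<le> \<bar>C\<bar> * M"
        using C[of u] M[OF u] mult_mono[OF abs_ge_self M[OF u], of C] by simp
      then have "norm (L u + b u) \<le> \<bar>C\<bar> * M + N"
        using N[OF u] by (rule norm_triangle_mono)
      then have "norm (damp \<tau> u (L u + b u)) \<le> \<bar>C\<bar> * M + N"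
        using norm_damp_le order_trans by blast
      then have "norm ((t * h) *\<^sub>R damp \<tau> u (L u + b u)) \<le> \<bar>t * h\<bar> * (\<bar>C\<bar> * M + N)"
        unfolding norm_scaleR by (intro mult_left_mono) auto
      then show ?thesis unfolding eq[symmetric]
        using M[OF u] norm_triangle_ineq4[of u "(t * h) *\<^sub>R damp \<tau> u (L u + b u)"] by linarith
    qed
    then show ?thesis by (auto simp: bounded_iff)
  qed
  moreover have "U 0 u = u" "K 0 u = 0" for u by (simp_all add: U_def K_def)
  ultimately show ?thesis
    unfolding Gamma_class_def eq using contU contK by blast
qed

end

subsection \<open>Discrete gradient descent\<close>

text \<open>The displacement bound combines \<open>h * g j \<le> h * (\<mu> / 2 + (g j)\<^sup>2 / (2 * \<mu>))\<close> with the decrease of \<open>f\<close>;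
  it keeps the sequence in the region where the step estimates hold.\<close>

lemma discrete_descent:
  fixes x :: "nat \<Rightarrow> 'a::real_normed_vector" and f g :: "nat \<Rightarrow> real"
  assumes pos: "h \<ge> 0" "\<mu> > 0" "m \<ge> 0" "\<kappa> > 0"
    and step: "\<And>j. j < N \<Longrightarrow> norm (x j - x 0) \<le> D \<Longrightarrow> f j \<le> f 0 \<Longrightarrow>
      m \<le> g j \<and> norm (x (Suc j) - x j) \<le> h * g j \<and> f (Suc j) \<le> f j - \<kappa> * h * (g j)\<^sup>2"
    and low: "\<And>j. j \<le> N \<Longrightarrow> f 0 - \<delta> \<le> f j"
    and D: "real N * h * (\<mu> / 2) + \<delta> / (2 * \<kappa> * \<mu>) \<le> D"
  shows "f N \<le> f 0 - \<kappa> * (real N * h) * m\<^sup>2"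
proof -
  \<comment> \<open>Both bounds are proved together because \<open>step\<close> requires nearness
    and \<open>f j \<le> f 0\<close>. The displacement is charged partly to elapsed time and partly
    to the decrease of \<open>f\<close>; both contributions telescope.\<close>
  have "norm (x j - x 0) \<le> real j * h * (\<mu> / 2) + (f 0 - f j) / (2 * \<kappa> * \<mu>)
      \<and> f j \<le> f 0 - \<kappa> * (real j * h) * m\<^sup>2" if "j \<le> N" for j
    using that
  proof (induction j)
    case (Suc j)
    then have j: "j < N" and IH1: "norm (x j - x 0) \<le> real j * h * (\<mu> / 2) + (f 0 - f j) / (2 * \<kappa> * \<mu>)"
      and IH2: "f j \<le> f 0 - \<kappa> * (real j * h) * m\<^sup>2" by auto
    have k\<mu>: "2 * \<kappa> * \<mu> > 0" using pos by simp
    have "real j * h * (\<mu> / 2) \<le> real N * h * (\<mu> / 2)"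
      using j pos by (intro mult_right_mono) auto
    moreover have "(f 0 - f j) / (2 * \<kappa> * \<mu>) \<le> \<delta> / (2 * \<kappa> * \<mu>)"
      using low[of j] j k\<mu> by (intro divide_right_mono) auto
    ultimately have "norm (x j - x 0) \<le> D" using IH1 D by linarith
    moreover have "0 \<le> \<kappa> * (real j * h) * m\<^sup>2" using pos by simp
    then have "f j \<le> f 0" using IH2 by linarith
    ultimately have st: "m \<le> g j" "norm (x (Suc j) - x j) \<le> h * g j" "f (Suc j) \<le> f j - \<kappa> * h * (g j)\<^sup>2"
      using step[OF j] by auto
    have "m\<^sup>2 \<le> (g j)\<^sup>2" using st(1) pos by (intro power_mono) auto
    then have "\<kappa> * h * m\<^sup>2 \<le> \<kappa> * h * (g j)\<^sup>2" using pos by (intro mult_left_mono) auto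
    then have 2: "f (Suc j) \<le> f 0 - \<kappa> * (real (Suc j) * h) * m\<^sup>2"
      using st(3) IH2 by (simp add: algebra_simps)
    have "0 \<le> (g j - \<mu>)\<^sup>2" by simp
    then have "2 * \<mu> * g j \<le> \<mu>\<^sup>2 + (g j)\<^sup>2" by (simp add: power2_diff algebra_simps)
    then have "g j \<le> (\<mu>\<^sup>2 + (g j)\<^sup>2) / (2 * \<mu>)" using pos by (simp add: pos_le_divide_eq mult.commute)
    also have "\<dots> = \<mu> / 2 + (g j)\<^sup>2 / (2 * \<mu>)"
      using pos by (simp add: add_divide_distrib power2_eq_square)
    finally have "h * g j \<le> h * (\<mu> / 2 + (g j)\<^sup>2 / (2 * \<mu>))" using pos by (intro mult_left_mono)
    also have "\<dots> = h * (\<mu> / 2) + (\<kappa> * h * (g j)\<^sup>2) / (2 * \<kappa> * \<mu>)"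
      using pos by (simp add: field_simps)
    also have "\<dots> \<le> h * (\<mu> / 2) + (f j - f (Suc j)) / (2 * \<kappa> * \<mu>)"
      using st(3) k\<mu> by (intro add_left_mono divide_right_mono) auto
    finally have "norm (x (Suc j) - x j) \<le> h * (\<mu> / 2) + (f j - f (Suc j)) / (2 * \<kappa> * \<mu>)"
      using st(2) by linarith
    moreover have "norm (x (Suc j) - x 0) \<le> norm (x (Suc j) - x j) + norm (x j - x 0)"
      using norm_triangle_ineq[of "x (Suc j) - x j" "x j - x 0"] by simp
    ultimately have "norm (x (Suc j) - x 0) \<le> h * (\<mu> / 2) + (f j - f (Suc j)) / (2 * \<kappa> * \<mu>)
        + (real j * h * (\<mu> / 2) + (f 0 - f j) / (2 * \<kappa> * \<mu>))"
      using IH1 by linarith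
    also have "\<dots> = real (Suc j) * h * (\<mu> / 2) + (f 0 - f (Suc j)) / (2 * \<kappa> * \<mu>)"
      by (simp add: algebra_simps diff_divide_distrib)
    finally show ?case using 2 by blast
  qed simp
  then show ?thesis by blast
qed

lemma funpow_increase_le:
  fixes f :: "'a \<Rightarrow> real"
  assumes "\<And>u. u \<in> A \<Longrightarrow> T u \<in> A" "\<And>u. u \<in> A \<Longrightarrow> f (T u) \<le> f u + c" "u \<in> A"
  shows "(T ^^ n) u \<in> A" "f ((T ^^ n) u) \<le> f u + real n * c"
proof -
  have "(T ^^ n) u \<in> A \<and> f ((T ^^ n) u) \<le> f u + real n * c"
  proof (induction n)
    case (Suc n)
    then show ?case using assms(1,2)[of "(T ^^ n) u"] by (auto simp: algebra_simps)
  qed (use assms in simp)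
  then show "(T ^^ n) u \<in> A" "f ((T ^^ n) u) \<le> f u + real n * c" by auto
qed

text \<open>The quadratic part contributes exactly \<open>1/2 * (L w \<bullet> w)\<close>, which is
  at most \<open>e / 2 * norm w\<close> once \<open>norm w \<le> e / C\<close>; the other half of
  the error is left for \<open>B\<close>.\<close>

lemma uniform_gradient_remainder:
  fixes B :: "'a::real_inner \<Rightarrow> real"
  assumes L: "bounded_linear L" and sym: "\<And>x y. L x \<bullet> y = x \<bullet> L y"
    and I: "\<And>u. I u = 1/2 * (L u \<bullet> u) + B u"
    and B: "\<And>u. (B has_derivative (\<lambda>w. b u \<bullet> w)) (at u)"
    and ud: "uniformly_differentiable_on_bounded B" and r: "r > 0" and e: "e > 0"
  obtains d where "d > 0"
    "\<And>u w. norm u \<le> r \<Longrightarrow> norm w \<le> d \<Longrightarrow> \<bar>I (u + w) - I u - (L u + b u) \<bullet> w\<bar> \<le> e * norm w"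
proof -
  interpret bounded_linear L by fact
  obtain C where C: "C > 0" "\<And>x. norm (L x) \<le> norm x * C" using pos_bounded by blast
  have fr: "frechet_derivative B (at u) = (\<lambda>w. b u \<bullet> w)" for u
    using frechet_derivative_at[OF B] by simp
  obtain d where d: "d > 0" "\<And>u w. norm u \<le> r + 1 \<Longrightarrow> norm (u + w) \<le> r + 1 \<Longrightarrow> norm w \<le> d \<Longrightarrow>
      \<bar>B (u + w) - B u - b u \<bullet> w\<bar> \<le> e / 2 * norm w"
  proof -
    \<comment> \<open>The radius is enlarged by 1 so that \<open>u + w\<close> stays in the ball for
      \<open>norm w \<le> 1\<close>.\<close>
    have "r + 1 > 0" "e / 2 > 0" using r e by auto
    then show ?thesis
      using ud that unfolding uniformly_differentiable_on_bounded_def fr mem_cball_0 by meson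
  qed
  define d' where "d' = min (min d 1) (e / C)"
  have "d' > 0" using d C e by (simp add: d'_def)
  moreover have "\<bar>I (u + w) - I u - (L u + b u) \<bullet> w\<bar> \<le> e * norm w"
    if u: "norm u \<le> r" and w: "norm w \<le> d'" for u w
  proof -
    have w': "norm w \<le> d" "norm w \<le> 1" "norm w \<le> e / C" using w by (auto simp: d'_def)
    have "norm (u + w) \<le> r + 1" using norm_triangle_ineq[of u w] u w' by linarith
    then have 1: "\<bar>B (u + w) - B u - b u \<bullet> w\<bar> \<le> e / 2 * norm w" using d u w' by simp
    have "\<bar>L w \<bullet> w\<bar> \<le> norm w * C * norm w"
      using Cauchy_Schwarz_ineq2[of "L w" w] mult_right_mono[OF C(2)[of w], of "norm w"] by simp
    also have "\<dots> \<le> e * norm w" using w' C by (intro mult_right_mono) (auto simp: field_simps)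
    finally have 2: "\<bar>L w \<bullet> w\<bar> \<le> e * norm w" .
    have "L w \<bullet> u = L u \<bullet> w" using sym[of w u] by (simp add: inner_commute)
    then have "I (u + w) - I u - (L u + b u) \<bullet> w = (B (u + w) - B u - b u \<bullet> w) + 1/2 * (L w \<bullet> w)"
      unfolding I add inner_add_left inner_add_right by (simp add: inner_commute algebra_simps)
    then show ?thesis using 1 2 by linarith
  qed
  ultimately show ?thesis by (rule that)
qed

context orthogonal_splitting
begin

text \<open>\<open>L1\<close> and \<open>L2\<close> are controlled only on their own subspaces, so
  every argument is kept in the form \<open>P1 x\<close> or \<open>P2 x\<close>; orthogonality
  removes the cross terms.\<close>

lemma selfadjoint_sum:
  assumes L: "\<And>u. L u = L1 (P1 u) + L2 (P2 u)"
    and L1: "bounded_selfadjoint_on E1 L1" and L2: "bounded_selfadjoint_on E2 L2"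
  shows "bounded_linear L" "P1 (L u) = L (P1 u)" "P2 (L u) = L (P2 u)" "L x \<bullet> y = x \<bullet> L y"
proof -
  note A1 = L1[unfolded bounded_selfadjoint_on_def] and A2 = L2[unfolded bounded_selfadjoint_on_def]
  have in1: "L1 (P1 u) \<in> E1" for u using conjunct1[OF A1] P1_in by (rule subsetD[OF _ imageI])
  have in2: "L2 (P2 u) \<in> E2" for u using conjunct1[OF A2] P2_in by (rule subsetD[OF _ imageI])
  have add: "L1 (P1 x + P1 y) = L1 (P1 x) + L1 (P1 y)" "L2 (P2 x + P2 y) = L2 (P2 x) + L2 (P2 y)" for x y
    using A1 A2 by (simp_all add: P1_in P2_in)
  have scale: "L1 (a *\<^sub>R P1 x) = a *\<^sub>R L1 (P1 x)" "L2 (a *\<^sub>R P2 x) = a *\<^sub>R L2 (P2 x)" for a x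
    using A1 A2 by (simp_all add: P1_in P2_in)
  have sa: "L1 (P1 x) \<bullet> P1 y = P1 x \<bullet> L1 (P1 y)" "L2 (P2 x) \<bullet> P2 y = P2 x \<bullet> L2 (P2 y)" for x y
    using A1 A2 by (simp_all add: P1_in P2_in)
  obtain C1 where C1: "\<And>x. norm (L1 (P1 x)) \<le> C1 * norm (P1 x)"
    using A1 P1_in by meson
  obtain C2 where C2: "\<And>x. norm (L2 (P2 x)) \<le> C2 * norm (P2 x)"
    using A2 P2_in by meson
  show "bounded_linear L"
  proof (rule bounded_linear_intro[where K = "\<bar>C1\<bar> + \<bar>C2\<bar>"])
    show "L (x + y) = L x + L y" for x y by (simp add: L P_add add)
    show "L (a *\<^sub>R x) = a *\<^sub>R L x" for a x by (simp add: L P_scaleR scale scaleR_add_right)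
    show "norm (L x) \<le> norm x * (\<bar>C1\<bar> + \<bar>C2\<bar>)" for x
    proof -
      have "norm (L1 (P1 x)) \<le> \<bar>C1\<bar> * norm x"
        using C1[of x] mult_mono[OF abs_ge_self[of C1] norm_P1[of x]] by simp
      moreover have "norm (L2 (P2 x)) \<le> \<bar>C2\<bar> * norm x"
        using C2[of x] mult_mono[OF abs_ge_self[of C2] norm_P2[of x]] by simp
      ultimately have "norm (L x) \<le> \<bar>C1\<bar> * norm x + \<bar>C2\<bar> * norm x"
        unfolding L by (rule norm_triangle_mono)
      then show ?thesis by (simp add: algebra_simps)
    qed
  qed
  have "L1 0 = 0" "L2 0 = 0" using scale(1)[of 0 0] scale(2)[of 0 0] by simp_all
  then show "P1 (L u) = L (P1 u)" "P2 (L u) = L (P2 u)"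
    by (simp_all add: L P1_eqI P2_eqI in1 in2 P1_E1 P2_E1 P1_E2 P2_E2 P1_in P2_in)
  have expand: "a \<bullet> v = a \<bullet> P1 v" if "a \<in> E1" for a v
    using inner_add_right[of a "P1 v" "P2 v"] inner_E1_E2[OF that P2_in] by (simp add: P1_plus_P2)
  have expand2: "a \<bullet> v = a \<bullet> P2 v" if "a \<in> E2" for a v
    using inner_add_right[of a "P1 v" "P2 v"] inner_E1_E2[OF P1_in that, of v]
    by (simp add: P1_plus_P2 inner_commute)
  have form: "L x \<bullet> y = L1 (P1 x) \<bullet> P1 y + L2 (P2 x) \<bullet> P2 y" for x y
    unfolding L inner_add_left by (simp only: expand[OF in1, of x y] expand2[OF in2, of x y])
  show "L x \<bullet> y = x \<bullet> L y"
    using form[of x y] form[of y x] sa[of x y] by (simp add: inner_commute)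
qed

lemma norm_le_split_ball:
  assumes "u \<in> split_ball E1 E2 \<tau>"
  shows "norm u \<le> 2 * \<tau>"
  using assms norm_triangle_ineq[of "P1 u" "P2 u"] unfolding split_ball_iff P1_plus_P2 by linarith

text \<open>Here 3/2 is a rational upper bound for the square root of 2. The cruder factor 2 would
  be too weak for the bound \<open>5 / 4 * \<tau>\<close> on \<open>1 + norm (x j)\<close>
  below.\<close>

lemma norm_le_split_ball_three_halves:
  assumes "u \<in> split_ball E1 E2 \<tau>"
  shows "norm u \<le> 3 / 2 * \<tau>"
proof (rule power2_le_imp_le)
  have \<tau>: "0 \<le> \<tau>" using assms norm_ge_zero order_trans unfolding split_ball_iff by blast
  have "(norm (P1 u))\<^sup>2 \<le> \<tau>\<^sup>2" "(norm (P2 u))\<^sup>2 \<le> \<tau>\<^sup>2"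
    using assms unfolding split_ball_iff by (auto intro: power_mono)
  moreover have "(3 / 2 * \<tau>)\<^sup>2 = 9 / 4 * \<tau>\<^sup>2" by (simp add: power2_eq_square)
  ultimately show "(norm u)\<^sup>2 \<le> (3 / 2 * \<tau>)\<^sup>2"
    unfolding pythagoras[of u] using zero_le_power2[of \<tau>] by linarith
  show "0 \<le> 3 / 2 * \<tau>" using \<tau> by simp
qed

end

section \<open>Choice of the step size and the two energy estimates\<close>

theorem lemma3p1:
  fixes E1 E2 :: "'a::{real_inner, complete_space} set"
    and I B :: "'a \<Rightarrow> real"
    and I' :: "'a \<Rightarrow> 'a \<Rightarrow>\<^sub>L real"
    and L L1 L2 :: "'a \<Rightarrow> 'a"
    and R :: nat and s :: nat and \<rho> \<epsilon> :: real
  assumes "subspace E1" and "closed E1" and "E2 = E1\<^sup>\<bottom>"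
    and I_deriv: "\<And>u. (I has_derivative blinfun_apply (I' u)) (at u)"
    and I_C1: "continuous_on UNIV I'"
    and I1: "\<And>u. I u = 1/2 * (L u \<bullet> u) + B u"
    and L_eq: "\<And>u. L u = L1 (projector E1 E2 u) + L2 (projector E2 E1 u)"
    and "bounded_selfadjoint_on E1 L1" and "bounded_selfadjoint_on E2 L2"
    and I2: "weakly_continuous B" "uniformly_differentiable_on_bounded B"
    and "\<rho> > 0" and "0 < \<epsilon>" and "\<epsilon> < 1/10"
    and "s = (R + 2)^2"
  shows "\<exists>k::nat. k \<ge> 1 \<and> (\<exists>\<eta> \<in> Gamma_class E1 E2.
           (\<forall>u \<in> split_ball E1 E2 (real R + 2). \<forall>t \<in> {0..1}.
              I ((\<eta> t ^^ (k * s)) u) \<le> I u + \<rho>) \<and>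
           (\<forall>c::real.
              (\<forall>w \<in> split_ball E1 E2 (real R + 1) \<inter> I -` {c - \<epsilon>..c + \<epsilon>}.
                 norm (I' w) * (1 + norm w) \<ge> sqrt (2 * \<epsilon>)) \<longrightarrow>
              (\<forall>u \<in> split_ball E1 E2 (real R / 2) \<inter> I -` {c - \<epsilon>..c + \<epsilon>}.
                 I ((\<eta> 1 ^^ (k * s)) u) \<le> c - \<epsilon> / 2)))"
proof -
  interpret orthogonal_splitting E1 E2 by unfold_locales (use assms in auto)
  note L = selfadjoint_sum[OF L_eq \<open>bounded_selfadjoint_on E1 L1\<close> \<open>bounded_selfadjoint_on E2 L2\<close>]
  have cont_L: "continuous_on S L" for S by (rule linear_continuous_on[OF L(1)])
  define g where "g u = riesz (I' u)" for u
  define b where "b u = g u - L u" for u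
  have g_eq: "g u = L u + b u" for u by (simp add: b_def)
  have inner_g: "g u \<bullet> w = I' u w" for u w by (simp add: g_def inner_riesz)
  have norm_g: "norm (g u) = norm (I' u)" for u by (simp add: g_def norm_riesz)
  have "continuous_on UNIV g" unfolding g_def
    by (rule continuous_on_compose2[OF continuous_on_riesz[of UNIV] I_C1]) auto
  then have cont_b: "continuous_on UNIV b"
    unfolding b_def by (intro continuous_intros cont_L)
  have B_deriv: "(B has_derivative (\<lambda>w. b u \<bullet> w)) (at u)" for u
  proof -
    have "((\<lambda>u. I u - 1/2 * (L u \<bullet> u)) has_derivative
        (\<lambda>w. I' u w - 1/2 * (L u \<bullet> w + L w \<bullet> u))) (at u)"
      by (intro has_derivative_diff I_deriv has_derivative_mult_right has_derivative_inner
          bounded_linear_imp_has_derivative L(1) has_derivative_ident)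
    moreover have "(\<lambda>u. I u - 1/2 * (L u \<bullet> u)) = B" by (simp add: I1 fun_eq_iff)
    moreover have "I' u w - 1/2 * (L u \<bullet> w + L w \<bullet> u) = b u \<bullet> w" for w
    proof -
      have "L w \<bullet> u = L u \<bullet> w" using L(4)[of w u] by (simp add: inner_commute)
      then show ?thesis by (simp add: b_def inner_diff_left inner_g)
    qed
    ultimately show ?thesis by simp
  qed
  have comp_b: "compact_map b" by (rule compact_map_gradient[OF B_deriv cont_b I2])
  obtain C where C: "C > 0" "\<And>x. norm (L x) \<le> norm x * C"
    using bounded_linear.pos_bounded[OF L(1)] by blast

  \<comment> \<open>With \<open>\<tau> = R + 2\<close> the cutoffs equal 1 on the split ball of
    radius \<open>\<tau> - 1 = R + 1\<close>, where the gradient hypothesis of (ii) is stated;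
    \<open>A\<close>, of radius \<open>\<tau> + 1\<close>, will be invariant.\<close>
  define \<tau> where "\<tau> = real R + 2"
  define A where "A = split_ball E1 E2 (\<tau> + 1)"
  have \<tau>: "\<tau> \<ge> 2" by (simp add: \<tau>_def)
  have s\<tau>: "real s = \<tau>\<^sup>2" using \<open>s = (R + 2)^2\<close> by (simp add: \<tau>_def)
  define rad where "rad = 2 * (\<tau> + 1)"
  have rad: "rad > 0" using \<tau> by (simp add: rad_def)
  have A_rad: "norm u \<le> rad" if "u \<in> A" for u
    using norm_le_split_ball that unfolding A_def rad_def by blast
  \<comment> \<open>Compactness of \<open>b\<close> is what bounds the gradient on the bounded set
    \<open>A\<close>, even in infinite dimension.\<close>
  obtain M where M: "M > 0" "\<And>u. u \<in> A \<Longrightarrow> norm (g u) \<le> M"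
  proof -
    have "compact (closure (b ` cball 0 rad))"
      using comp_b bounded_cball unfolding compact_map_def by blast
    then have "bounded (b ` cball 0 rad)"
      using compact_imp_bounded bounded_subset closure_subset by metis
    then obtain N where "\<And>y. y \<in> b ` cball 0 rad \<Longrightarrow> norm y \<le> N" unfolding bounded_iff by blast
    then have N: "norm (b u) \<le> N" if "norm u \<le> rad" for u using that by simp
    have "norm (g u) \<le> rad * C + N" if "u \<in> A" for u
      unfolding g_eq using A_rad[OF that] C(1) N order_trans[OF C(2) mult_right_mono[of _ rad]]
      by (intro norm_triangle_mono) auto
    then show ?thesis using that[of "max 1 (rad * C + N)"] by fastforce
  qed

  \<comment> \<open>\<open>T\<close> is the total time \<open>N * h\<close>, and \<open>m\<close>
    the gradient bound that follows from \<open>1 + norm w \<le> 5 / 4 * \<tau>\<close>.\<close>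
  define T where "T = 13 / 10 * \<tau>\<^sup>2"
  define m where "m = sqrt (2 * \<epsilon>) / (5 / 4 * \<tau>)"
  \<comment> \<open>The three entries keep the error of an undamped step within 1/20 of its descent,
    the accumulated error within \<open>\<rho>\<close>, and the accumulated error within
    \<open>\<epsilon> / 20\<close>.\<close>
  define e where "e = min (m / 20) (min (\<rho> / (M * T)) (\<epsilon> / (20 * (M * T))))"
  have T: "T > 0" using \<tau> by (simp add: T_def)
  have m: "m > 0" using \<tau> \<open>0 < \<epsilon>\<close> by (simp add: m_def)
  have MT: "M * T > 0" using M T by simp
  have e: "e > 0" using m MT \<open>\<rho> > 0\<close> \<open>0 < \<epsilon>\<close> by (simp add: e_def)
  have em: "e \<le> m / 20" unfolding e_def by (rule min.cobounded1)
  have "e \<le> \<rho> / (M * T)" "e \<le> \<epsilon> / (20 * (M * T))" unfolding e_def by (simp_all add: min.coboundedI2)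
  then have "e * (M * T) \<le> \<rho>" "e * (20 * (M * T)) \<le> \<epsilon>"
    using MT pos_le_divide_eq[of "M * T"] pos_le_divide_eq[of "20 * (M * T)"] by simp_all
  then have eMT: "e * (M * T) \<le> \<rho>" "e * (M * T) \<le> \<epsilon> / 20"
    by (simp_all add: mult.left_commute[of e 20])
  obtain d where d: "d > 0" "\<And>u w. norm u \<le> rad \<Longrightarrow> norm w \<le> d \<Longrightarrow>
      \<bar>I (u + w) - I u - (L u + b u) \<bullet> w\<bar> \<le> e * norm w"
    using uniform_gradient_remainder[OF L(1) L(4) I1 B_deriv I2(2) rad e] by blast

  \<comment> \<open>Steps shorter than \<open>d\<close> obey the remainder estimate, steps of length
    at most 1 preserve \<open>A\<close>.\<close>
  define \<nu> where "\<nu> = min d 1"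
  define q where "q = C * (2 * (1 + \<tau>))"
  \<comment> \<open>\<open>k > Q\<close> yields both \<open>h * M \<le> \<nu>\<close> and
    \<open>h * q < 1\<close>, where \<open>q\<close> is the Lipschitz constant of the damped linear
    part.\<close>
  define Q where "Q = 13 / 10 * (M / \<nu> + q)"
  obtain k :: nat where kQ: "real k > max Q 1" using reals_Archimedean2 by blast
  then have k: "k \<ge> 1" "real k > Q" by auto
  define h where "h = 13 / 10 / real k"
  define N where "N = k * s"
  have h: "h > 0" using k by (simp add: h_def)
  have Nh: "real N * h = T" using k by (simp add: N_def h_def T_def s\<tau>)
  have \<nu>: "\<nu> > 0" using d by (simp add: \<nu>_def)
  have "M / \<nu> > 0" "q > 0" using M C \<tau> \<nu> by (simp_all add: q_def)
  then have "13 / 10 * (M / \<nu>) \<le> real k" "13 / 10 * q < real k"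
    using k(2) unfolding Q_def by argo+
  then have hM: "h * M \<le> \<nu>" and hq: "h * q < 1"
    using k(1) \<nu> by (simp_all add: h_def field_simps)
  have \<nu>_le: "\<nu> \<le> d" "\<nu> \<le> 1" by (simp_all add: \<nu>_def)

  define \<eta> where "\<eta> = (\<lambda>t u. u - (t * h) *\<^sub>R damp \<tau> u (L u + b u))"
  have \<eta>_Gamma: "\<eta> \<in> Gamma_class E1 E2"
    unfolding \<eta>_def
    using L(1-3) C(2) comp_b \<tau> h hq[unfolded q_def] by (intro damped_step_in_Gamma_class) (auto simp: mult.commute)
  have step: "\<eta> t u \<in> A"
    "I (\<eta> t u) \<le> I u - (t * h) * (g u \<bullet> damp \<tau> u (g u)) + e * ((t * h) * norm (damp \<tau> u (g u)))"
    if t: "t \<in> {0..1}" and u: "u \<in> A" for t u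
  proof -
    have th: "0 \<le> t * h" "t * h \<le> h" using t h by (auto simp: mult_le_cancel_right1)
    have thM: "t * h * norm (g u) \<le> h * M"
      using th h M(2)[OF u] by (intro mult_mono) auto
    show "\<eta> t u \<in> A"
      unfolding \<eta>_def g_eq[symmetric] A_def
      using u th(1) thM hM \<nu>_le by (intro damped_step_in_split_ball) (auto simp: A_def)
    define w where "w = - ((t * h) *\<^sub>R damp \<tau> u (g u))"
    have nw: "norm w = t * h * norm (damp \<tau> u (g u))" using th by (simp add: w_def)
    also have "\<dots> \<le> t * h * norm (g u)" using th norm_damp_le by (intro mult_left_mono) auto
    finally have "norm w \<le> d" using thM hM \<nu>_le by linarith
    then have "\<bar>I (u + w) - I u - g u \<bullet> w\<bar> \<le> e * norm w"
      using d(2) A_rad[OF u] unfolding g_eq by blast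
    moreover have "u + w = \<eta> t u" by (simp add: \<eta>_def w_def g_eq[symmetric])
    moreover have "g u \<bullet> w = - ((t * h) * (g u \<bullet> damp \<tau> u (g u)))" by (simp add: w_def)
    ultimately show "I (\<eta> t u) \<le> I u - (t * h) * (g u \<bullet> damp \<tau> u (g u)) + e * ((t * h) * norm (damp \<tau> u (g u)))"
      using nw by (simp add: mult.assoc)
  qed
  \<comment> \<open>The first-order term never raises \<open>I\<close>, by
    \<open>inner_damp\<close>; only the remainder can.\<close>
  have increase: "I (\<eta> t u) \<le> I u + e * (h * M)" if t: "t \<in> {0..1}" and u: "u \<in> A" for t u
  proof -
    have th: "0 \<le> t * h" "t * h \<le> h" using t h by (auto simp: mult_le_cancel_right1)
    have "0 \<le> (t * h) * (g u \<bullet> damp \<tau> u (g u))" using th(1) inner_damp by (rule mult_nonneg_nonneg)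
    moreover have "norm (damp \<tau> u (g u)) \<le> M" using norm_damp_le M(2)[OF u] order_trans by blast
    then have "e * ((t * h) * norm (damp \<tau> u (g u))) \<le> e * (h * M)"
      using e th h by (intro mult_left_mono mult_mono) auto
    ultimately show ?thesis using step(2)[OF t u] by linarith
  qed
  have total: "real n * (e * (h * M)) \<le> e * (M * T)" if "n \<le> N" for n
  proof -
    have "real n * (e * (h * M)) \<le> real N * (e * (h * M))"
      using that e h M by (intro mult_right_mono) auto
    also have "\<dots> = e * (M * (real N * h))" by (simp add: mult_ac)
    finally show ?thesis unfolding Nh .
  qed
  have iter: "(\<eta> t ^^ n) u \<in> A" "I ((\<eta> t ^^ n) u) \<le> I u + real n * (e * (h * M))"
    if "t \<in> {0..1}" "u \<in> A" for t u n
    using funpow_increase_le[of A "\<eta> t" I "e * (h * M)" u n] step(1) increase that by blast+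

  have part1: "I ((\<eta> t ^^ N) u) \<le> I u + \<rho>" if u: "u \<in> split_ball E1 E2 (real R + 2)" and t: "t \<in> {0..1}" for u t
  proof -
    have "u \<in> A" using u by (simp add: A_def split_ball_iff \<tau>_def)
    then show ?thesis using iter(2)[OF t, of u N] total[of N] eMT by simp
  qed
  have part2: "I ((\<eta> 1 ^^ N) u) \<le> c - \<epsilon> / 2"
    if grad: "\<forall>w \<in> split_ball E1 E2 (real R + 1) \<inter> I -` {c - \<epsilon>..c + \<epsilon>}. norm (I' w) * (1 + norm w) \<ge> sqrt (2 * \<epsilon>)"
      and u: "u \<in> split_ball E1 E2 (real R / 2) \<inter> I -` {c - \<epsilon>..c + \<epsilon>}" for c u
  proof (rule ccontr)
    assume "\<not> ?thesis"
    then have final: "I ((\<eta> 1 ^^ N) u) > c - \<epsilon> / 2" by simp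
    define x where "x j = (\<eta> 1 ^^ j) u" for j
    have u_half: "norm (P1 u) \<le> real R / 2" "norm (P2 u) \<le> real R / 2" using u by (auto simp: split_ball_iff)
    then have "u \<in> A" by (simp add: A_def split_ball_iff \<tau>_def)
    then have xA: "x j \<in> A" for j unfolding x_def by (intro iter) auto
    have norm_u: "norm u \<le> 3 / 4 * real R" using u norm_le_split_ball_three_halves by fastforce
    have x0: "x 0 = u" by (simp add: x_def)
    have Iu: "c - \<epsilon> \<le> I u" "I u \<le> c + \<epsilon>" using u by auto
    \<comment> \<open>From time \<open>j\<close> to \<open>N\<close> the energy rises by at most
      \<open>\<epsilon> / 20\<close>, so a final value above \<open>c - \<epsilon> / 2\<close> keeps
      all earlier values above \<open>c - 11 / 20 * \<epsilon>\<close>, inside the band.\<close>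
    have low: "c - 11 / 20 * \<epsilon> \<le> I (x j)" if "j \<le> N" for j
    proof -
      have "x N = (\<eta> 1 ^^ (N - j)) (x j)"
        unfolding x_def using that by (metis comp_apply funpow_add le_add_diff_inverse2)
      then have "I (x N) \<le> I (x j) + \<epsilon> / 20"
        using iter(2)[of 1 "x j" "N - j"] xA total[of "N - j"] eMT by simp
      then show ?thesis using final by (simp add: x_def)
    qed
    have desc: "m \<le> norm (g (x j)) \<and> norm (x (Suc j) - x j) \<le> h * norm (g (x j))
        \<and> I (x (Suc j)) \<le> I (x j) - 19 / 20 * h * (norm (g (x j)))\<^sup>2"
      if j: "j < N" and near: "norm (x j - x 0) \<le> \<tau> / 2" and below: "I (x j) \<le> I (x 0)" for j
    proof -
      \<comment> \<open>Components start within \<open>R / 2\<close> and move by at most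
        \<open>\<tau> / 2 = R / 2 + 1\<close>, so they stay within
        \<open>R + 1 = \<tau> - 1\<close>.\<close>
      have near': "norm (P1 (x j) - P1 u) \<le> \<tau> / 2" "norm (P2 (x j) - P2 u) \<le> \<tau> / 2"
        using near norm_P1[of "x j - u"] norm_P2[of "x j - u"] unfolding x0 P_diff by linarith+
      have in_ball: "x j \<in> split_ball E1 E2 (\<tau> - 1)"
        unfolding split_ball_iff
        using near' u_half norm_triangle_sub[of "P1 (x j)" "P1 u"] norm_triangle_sub[of "P2 (x j)" "P2 u"]
        by (simp add: \<tau>_def)
      moreover have "I (x j) \<in> {c - \<epsilon>..c + \<epsilon>}"
        using low[of j] j below Iu \<open>0 < \<epsilon>\<close> unfolding x0 by simp
      ultimately have "sqrt (2 * \<epsilon>) \<le> norm (g (x j)) * (1 + norm (x j))"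
        using grad unfolding norm_g \<tau>_def by (simp add: add.commute)
      \<comment> \<open>\<open>1 + 3 / 4 * R + (R + 2) / 2 = 5 / 4 * R + 2\<close>, which is below
        \<open>5 / 4 * (R + 2)\<close>.\<close>
      also have "\<dots> \<le> norm (g (x j)) * (5 / 4 * \<tau>)"
        using near norm_u norm_triangle_sub[of "x j" u] unfolding x0
        by (intro mult_left_mono) (simp_all add: \<tau>_def)
      finally have mg: "m \<le> norm (g (x j))" using \<tau> by (simp add: m_def field_simps)
      have damp_g: "damp \<tau> (x j) (g (x j)) = g (x j)" by (rule damp_eq_self[OF in_ball])
      have xSuc: "x (Suc j) = \<eta> 1 (x j)" by (simp add: x_def)
      have "x (Suc j) - x j = - (h *\<^sub>R g (x j))"
        unfolding xSuc by (simp add: \<eta>_def g_eq[symmetric] damp_g)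
      then have n: "norm (x (Suc j) - x j) \<le> h * norm (g (x j))" using h by simp
      have "I (x (Suc j)) \<le> I (x j) - h * (norm (g (x j)))\<^sup>2 + e * (h * norm (g (x j)))"
        using step(2)[of 1 "x j"] xA[of j] unfolding xSuc damp_g by (simp add: power2_norm_eq_inner)
      also have "e * (h * norm (g (x j))) \<le> norm (g (x j)) / 20 * (h * norm (g (x j)))"
        using em mg h by (intro mult_right_mono) auto
      finally have "I (x (Suc j)) \<le> I (x j) - 19 / 20 * h * (norm (g (x j)))\<^sup>2"
        by (simp add: power2_eq_square algebra_simps)
      with mg n show ?thesis by blast
    qed
    have "I (x N) \<le> I (x 0) - 19 / 20 * (real N * h) * m\<^sup>2"
    \<comment> \<open>\<open>\<delta>\<close> is the distance from the top
      \<open>c + \<epsilon>\<close> of the band to the level in \<open>low\<close>. The value of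
      \<open>\<mu>\<close> nearly balances the two displacement terms when \<open>\<epsilon>\<close>
      is close to 1/10.\<close>
    proof (rule discrete_descent[where x = x and \<mu> = "7 / (20 * \<tau>)" and \<delta> = "31 / 20 * \<epsilon>" and D = "\<tau> / 2"
          and g = "\<lambda>j. norm (g (x j))"])
      show "I (x 0) - 31 / 20 * \<epsilon> \<le> I (x j)" if "j \<le> N" for j
        using low[OF that] Iu unfolding x0 by linarith
      have "real N * h * (7 / (20 * \<tau>) / 2) + 31 / 20 * \<epsilon> / (2 * (19 / 20) * (7 / (20 * \<tau>)))
          = (91 / 400 + 310 / 133 * \<epsilon>) * \<tau>"
        using \<tau> unfolding Nh T_def by (simp add: power2_eq_square field_simps)
      \<comment> \<open>For \<open>\<epsilon> < 1/10\<close> the coefficient is below 0.461.\<close>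
      also have "\<dots> \<le> 1 / 2 * \<tau>" using \<open>\<epsilon> < 1/10\<close> \<tau> by (intro mult_right_mono) auto
      finally show "real N * h * (7 / (20 * \<tau>) / 2) + 31 / 20 * \<epsilon> / (2 * (19 / 20) * (7 / (20 * \<tau>))) \<le> \<tau> / 2"
        by simp
    qed (use h m \<tau> desc in auto)
    \<comment> \<open>The loss is
      \<open>19 / 20 * 208 / 125 * \<epsilon> = 1.5808 * \<epsilon>\<close>, more than the
      \<open>3 / 2 * \<epsilon>\<close> separating \<open>c + \<epsilon>\<close> from
      \<open>c - \<epsilon> / 2\<close>.\<close>
    moreover have "T * m\<^sup>2 = 208 / 125 * \<epsilon>"
      using \<tau> \<open>0 < \<epsilon>\<close> unfolding T_def m_def by (simp add: power_divide power_mult_distrib field_simps power2_eq_square)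
    ultimately show False
      using final Iu \<open>0 < \<epsilon>\<close> unfolding Nh x0 by (simp add: x_def)
  qed
  show ?thesis
    using k(1) \<eta>_Gamma part1 part2 unfolding N_def by blast
qed

end
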